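(* Let $\Gamma$ be a nonlinear connection on $E=J^1(\mathbb{R},M)$ and let $\nabla$ be a $\Gamma$-linear connection on $E$. The deflection d-tensors $\bar D_{(1)1}^{(i)}$, $D_{(1)j}^{(i)}$, $d_{(1)(j)}^{(i)(1)}$ attached to $\nabla$ satisfy the identities $$\bar D_{(1)1|k}^{(i)}-D_{(1)k/1}^{(i)}=y_1^rR_{(1)(r)1k}^{(i)(1)}-\bar D_{(1)1}^{(i)}\bar T_{1k}^1-D_{(1)r}^{(i)}T_{1k}^r-d_{(1)(r)}^{(i)(1)}R_{(1)1k}^{(r)},$$ $$D_{(1)j|k}^{(i)}-D_{(1)k|j}^{(i)}=y_1^rR_{(1)(r)jk}^{(i)(1)}-D_{(1)r}^{(i)}T_{jk}^r-d_{(1)(r)}^{(i)(1)}R_{(1)jk}^{(r)},$$ $$\bar D_{(1)1}^{(i)}|_{(k)}^{(1)}-d_{(1)(k)/1}^{(i)(1)}=y_1^rP_{(1)(r)1(k)}^{(i)(1)\;\;(1)}-\bar D_{(1)1}^{(i)}\bar C_{1(k)}^{1(1)}-d_{(1)(r)}^{(i)(1)}P_{(1)1(k)}^{(r)\;\;(1)},$$ $$D_{(1)j}^{(i)}|_{(k)}^{(1)}-d_{(1)(k)|j}^{(i)(1)}=y_1^rP_{(1)(r)j(k)}^{(i)(1)\;\;(1)}-D_{(1)r}^{(i)}C_{j(k)}^{r(1)}-d_{(1)(r)}^{(i)(1)}P_{(1)j(k)}^{(r)\;\;(1)},$$ $$d_{(1)(j)}^{(i)(1)}|_{(k)}^{(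1)}-d_{(1)(k)}^{(i)(1)}|_{(j)}^{(1)}=y_1^rS_{(1)(r)(j)(k)}^{(i)(1)(1)(1)}-d_{(1)(r)}^{(i)(1)}S_{(1)(j)(k)}^{(r)(1)(1)}.$$
   Context: $M$ is a smooth $n$-dimensional manifold with local coordinates $(x^i)_{i=\overline{1,n}}$, $\mathbb{R}$ is the time manifold with coordinate $t$, and $E=J^1(\mathbb{R},M)\to\mathbb{R}\times M$ is the 1-jet vector bundle, with local coordinates $(t,x^i,y_1^i)$ transforming by $$\tilde t=\tilde t(t),\quad \tilde x^i=\tilde x^i(x^j),\quad \tilde y_1^i=\frac{\partial\tilde x^i}{\partial x^j}\frac{dt}{d\tilde t}\,y_1^j .$$ Latin indices run over $1,\dots,n$ and repeated Latin indices are summed; the index $1$ refers to the single time direction. A nonlinear connection $\Gamma=\left(M_{(1)1}^{(i)},N_{(1)j}^{(i)}\right)$ on $E$ is a family of local functions on the charts of $E$ transforming by $$\tilde M_{(1)1}^{(k)}=M_{(1)1}^{(j)}\left(\frac{dt}{d\tilde t}\right)^2\frac{\partial\tilde x^k}{\partial x^j}-\frac{dt}{d\tilde t}\frac{\partial\tilde y_1^k}{\partial t},\qquad \tilde N_{(1)l}^{(k)}=N_{(1)i}^{(j)}\frac{dt}{d\tilde t}\frac{\partial x^i}{\partial\tilde x^l}\frac{\partial\tilde x^k}{\partial x^j}-\frac{\partial x^i}{\partial\tilde x^l}\frac{\partial\tilde y_1^k}{\partial x^i}.$$ The adapted basis of vector fields is $$\frac{\delta}{\delta t}=\frac{\partial}{\partial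 t}-M_{(1)1}^{(j)}\frac{\partial}{\partial y_1^j},\quad \frac{\delta}{\delta x^i}=\frac{\partial}{\partial x^i}-N_{(1)i}^{(j)}\frac{\partial}{\partial y_1^j},\quad \frac{\partial}{\partial y_1^i}.$$ $h_{\mathbb{R}}$, $h_M$, $v$ denote the projections of $\mathcal{X}(E)$ onto the summands locally spanned respectively by $\frac{\delta}{\delta t}$, by the $\frac{\delta}{\delta x^i}$, by the $\frac{\partial}{\partial y_1^i}$. A $\Gamma$-linear connection on $E$ is a linear connection $\nabla$ on $E$ with $\nabla h_{\mathbb{R}}=0$, $\nabla h_M=0$, $\nabla v=0$, i.e. $\nabla_X(hY)=h(\nabla_XY)$ for $h\in\{h_{\mathbb{R}},h_M,v\}$. Its adapted coefficients in a chart are defined by $$\nabla_{\frac{\delta}{\delta t}}\frac{\delta}{\delta t}=\bar G_{11}^1\frac{\delta}{\delta t},\quad \nabla_{\frac{\delta}{\delta t}}\frac{\delta}{\delta x^i}=G_{i1}^k\frac{\delta}{\delta x^k},\quad \nabla_{\frac{\delta}{\delta t}}\frac{\partial}{\partial y_1^i}=G_{(1)(i)1}^{(k)(1)}\frac{\partial}{\partial y_1^k},$$ $$\nabla_{\frac{\delta}{\delta x^j}}\frac{\delta}{\delta t}=\bar L_{1j}^1\frac{\delta}{\delta t},\quad \nabla_{\frac{\delta}{\delta x^j}}\frac{\delta}{\delta x^i}=L_{ij}^k\frac{\delta}{\delta x^k},\quad \nabla_{\frac{\delta}{\delta x^j}}\frac{\partial}{\partial y_1^i}=L_{(1)(i)j}^{(k)(1)}\frac{\partial}{\partial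 y_1^k},$$ $$\nabla_{\frac{\partial}{\partial y_1^j}}\frac{\delta}{\delta t}=\bar C_{1(j)}^{1(1)}\frac{\delta}{\delta t},\quad \nabla_{\frac{\partial}{\partial y_1^j}}\frac{\delta}{\delta x^i}=C_{i(j)}^{k(1)}\frac{\delta}{\delta x^k},\quad \nabla_{\frac{\partial}{\partial y_1^j}}\frac{\partial}{\partial y_1^i}=C_{(1)(i)(j)}^{(k)(1)(1)}\frac{\partial}{\partial y_1^k}.$$ Torsion d-tensors: $$\bar T_{1j}^1=\bar L_{1j}^1,\quad T_{1j}^r=-G_{j1}^r,\quad T_{ij}^r=L_{ij}^r-L_{ji}^r,\quad S_{(1)(i)(j)}^{(r)(1)(1)}=C_{(1)(i)(j)}^{(r)(1)(1)}-C_{(1)(j)(i)}^{(r)(1)(1)},$$ $$P_{(1)1(j)}^{(r)\;(1)}=\frac{\partial M_{(1)1}^{(r)}}{\partial y_1^j}-G_{(1)(j)1}^{(r)(1)},\quad P_{(1)i(j)}^{(r)\;(1)}=\frac{\partial N_{(1)i}^{(r)}}{\partial y_1^j}-L_{(1)(j)i}^{(r)(1)},$$ $$R_{(1)1j}^{(r)}=\frac{\delta M_{(1)1}^{(r)}}{\delta x^j}-\frac{\delta N_{(1)j}^{(r)}}{\delta t},\quad R_{(1)ij}^{(r)}=\frac{\delta N_{(1)i}^{(r)}}{\delta x^j}-\frac{\delta N_{(1)j}^{(r)}}{\delta x^i}.$$ Vertical curvature d-tensors. With $\mathbf{R}(X,Y)Z=\nabla_X\nabla_YZ-\nabla_Y\nabla_XZ-\nabla_{[X,Y]}Z$,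 they are defined by $$\mathbf{R}\left(\tfrac{\delta}{\delta x^k},\tfrac{\delta}{\delta t}\right)\tfrac{\partial}{\partial y_1^i}=R_{(1)(i)1k}^{(l)(1)}\tfrac{\partial}{\partial y_1^l},\quad \mathbf{R}\left(\tfrac{\delta}{\delta x^k},\tfrac{\delta}{\delta x^j}\right)\tfrac{\partial}{\partial y_1^i}=R_{(1)(i)jk}^{(l)(1)}\tfrac{\partial}{\partial y_1^l},\quad \mathbf{R}\left(\tfrac{\partial}{\partial y_1^k},\tfrac{\delta}{\delta t}\right)\tfrac{\partial}{\partial y_1^i}=P_{(1)(i)1(k)}^{(l)(1)\;(1)}\tfrac{\partial}{\partial y_1^l},$$ $$\mathbf{R}\left(\tfrac{\partial}{\partial y_1^k},\tfrac{\delta}{\delta x^j}\right)\tfrac{\partial}{\partial y_1^i}=P_{(1)(i)j(k)}^{(l)(1)\;(1)}\tfrac{\partial}{\partial y_1^l},\quad \mathbf{R}\left(\tfrac{\partial}{\partial y_1^k},\tfrac{\partial}{\partial y_1^j}\right)\tfrac{\partial}{\partial y_1^i}=S_{(1)(i)(j)(k)}^{(l)(1)(1)(1)}\tfrac{\partial}{\partial y_1^l}.$$ Covariant derivatives. For a d-tensor with components $D_{1k(1)(l)\ldots}^{1i(j)(1)\ldots}$ (an upper $(j)$ paired with a lower $(1)$ is a vertical contravariant index, a lower $(l)$ paired with an upper $(1)$ is a vertical covariant index), $$D_{1k(1)(l)\ldots/1}^{1i(j)(1)\ldots}=\frac{\delta D_{1k(1)(l)\ldots}^{1i(j)(1)\ldots}}{\delta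 t}+D_{1k(1)(l)\ldots}^{1i(j)(1)\ldots}\bar G_{11}^1+D_{1k(1)(l)\ldots}^{1r(j)(1)\ldots}G_{r1}^i+D_{1k(1)(l)\ldots}^{1i(r)(1)\ldots}G_{(1)(r)1}^{(j)(1)}+\ldots$$ $$\qquad-D_{1k(1)(l)\ldots}^{1i(j)(1)\ldots}\bar G_{11}^1-D_{1r(1)(l)\ldots}^{1i(j)(1)\ldots}G_{k1}^r-D_{1k(1)(r)\ldots}^{1i(j)(1)\ldots}G_{(1)(l)1}^{(r)(1)}-\ldots,$$ with one plus-term for each contravariant index and one minus-term for each covariant index. $D_{\ldots|p}^{\ldots}$ is given by the same formula with $\frac{\delta}{\delta t},\bar G_{11}^1,G_{r1}^i,G_{(1)(r)1}^{(j)(1)}$ replaced by $\frac{\delta}{\delta x^p},\bar L_{1p}^1,L_{rp}^i,L_{(1)(r)p}^{(j)(1)}$, and $D_{\ldots}^{\ldots}|_{(p)}^{(1)}$ by the same formula with them replaced by $\frac{\partial}{\partial y_1^p},\bar C_{1(p)}^{1(1)},C_{r(p)}^{i(1)},C_{(1)(r)(p)}^{(j)(1)(1)}$ (and correspondingly for the other index letters). Deflection d-tensors. The canonical Liouville d-tensor field is $\mathbf{C}=\mathbf{C}_{(1)}^{(i)}\frac{\partial}{\partial y_1^i}$ with $\mathbf{C}_{(1)}^{(i)}=y_1^i$, and $$\bar D_{(1)1}^{(i)}=\mathbf{C}_{(1)/1}^{(i)},\quad D_{(1)j}^{(i)}=\mathbf{C}_{(1)|j}^{(i)},\quad d_{(1)(j)}^{(i)(1)}=\mathbf{C}_{(1)}^{(i)}|_{(j)}^{(1)}.$$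 In $\bar D_{(1)1}^{(i)}$ the last lower $1$ is a covariant time index, in $D_{(1)j}^{(i)}$ the lower $j$ is a covariant spatial index, in $d_{(1)(j)}^{(i)(1)}$ the pair $(j),(1)$ is a vertical covariant index; in all three the pair $(i),(1)$ (upper $(i)$, lower $(1)$) is a vertical contravariant index. *)

theory Defs
  imports "HOL-Analysis.Analysis"
begin

section \<open>Smooth maps on open sets of Euclidean spaces\<close>

primrec Ck_on :: "nat \<Rightarrow> 'a::euclidean_space set \<Rightarrow> ('a \<Rightarrow> 'b::real_normed_vector) \<Rightarrow> bool" where
  "Ck_on 0 S f \<longleftrightarrow> continuous_on S f"
| "Ck_on (Suc k) S f \<longleftrightarrow> (\<forall>x\<in>S. f differentiable (at x)) \<and>
     (\<forall>v. Ck_on k S (\<lambda>x. frechet_derivative f (at x) v))"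

text \<open>Only meaningful for open \<open>S\<close>.\<close>

definition smooth_on :: "'a::euclidean_space set \<Rightarrow> ('a \<Rightarrow> 'b::real_normed_vector) \<Rightarrow> bool" where
  "smooth_on S f \<longleftrightarrow> (\<forall>k. Ck_on k S f)"


section \<open>Smooth manifolds\<close>

text \<open>
  A chart is a pair of a domain and a coordinate map. A manifold is given by its atlas: the
  underlying set is the union of the chart domains and it carries the topology that makes the
  charts homeomorphisms onto open subsets of the model space. The atlas need not be maximal, but
  it may be.
\<close>

type_synonym ('p, 'v) chart = "'p set \<times> ('p \<Rightarrow> 'v)"

definition transition :: "('p, 'v) chart \<Rightarrow> ('p, 'v) chart \<Rightarrow> 'v \<Rightarrow> 'v" where
  "transition c c' = snd c' \<circ> inv_into (fst c) (snd c)"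

definition smooth_atlas :: "('p, 'v::euclidean_space) chart set \<Rightarrow> bool" where
  "smooth_atlas A \<longleftrightarrow>
     (\<forall>c\<in>A. inj_on (snd c) (fst c) \<and> open (snd c ` fst c)) \<and>
     (\<forall>c\<in>A. \<forall>c'\<in>A. open (snd c ` (fst c \<inter> fst c')) \<and>
        smooth_on (snd c ` (fst c \<inter> fst c')) (transition c c'))"

definition atlas_carrier :: "('p, 'v) chart set \<Rightarrow> 'p set" where
  "atlas_carrier A = (\<Union>c\<in>A. fst c)"

definition atlas_topology :: "('p, 'v::euclidean_space) chart set \<Rightarrow> 'p topology" where
  "atlas_topology A = topology (\<lambda>W. W \<subseteq> atlas_carrier A \<and> (\<forall>c\<in>A. open (snd c ` (W \<inter> fst c))))"

lemma openin_atlas_topology: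
  assumes "smooth_atlas A"
  shows "openin (atlas_topology A) W \<longleftrightarrow>
           W \<subseteq> atlas_carrier A \<and> (\<forall>c\<in>A. open (snd c ` (W \<inter> fst c)))"
proof -
  have "istopology (\<lambda>W. W \<subseteq> atlas_carrier A \<and> (\<forall>c\<in>A. open (snd c ` (W \<inter> fst c))))"
    unfolding istopology_def
  proof (rule conjI; clarify)
    fix S T
    assume S: "S \<subseteq> atlas_carrier A" "\<forall>c\<in>A. open (snd c ` (S \<inter> fst c))"
      and T: "T \<subseteq> atlas_carrier A" "\<forall>c\<in>A. open (snd c ` (T \<inter> fst c))"
    have "open (snd c ` (S \<inter> T \<inter> fst c))" if "c \<in> A" for c
    proof -
      have "inj_on (snd c) (fst c)"
        using assms that by (auto simp: smooth_atlas_def)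
      then have "snd c ` (S \<inter> T \<inter> fst c) = snd c ` (S \<inter> fst c) \<inter> snd c ` (T \<inter> fst c)"
        by (auto simp: inj_on_def)
      then show ?thesis
        using S T that by (simp add: open_Int)
    qed
    then show "S \<inter> T \<subseteq> atlas_carrier A \<and> (\<forall>c\<in>A. open (snd c ` (S \<inter> T \<inter> fst c)))"
      using S by blast
  next
    fix K
    assume K: "\<forall>W\<in>K. W \<subseteq> atlas_carrier A \<and> (\<forall>c\<in>A. open (snd c ` (W \<inter> fst c)))"
    have "open (snd c ` (\<Union>K \<inter> fst c))" if "c \<in> A" for c
    proof -
      have "snd c ` (\<Union>K \<inter> fst c) = (\<Union>W\<in>K. snd c ` (W \<inter> fst c))"
        by blast
      then show ?thesis
        using K that by auto
    qed
    then show "\<Union>K \<subseteq> atlas_carrier A \<and> (\<forall>c\<in>A. open (snd c ` (\<Union>K \<inter> fst c)))"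
      using K by blast
  qed
  then show ?thesis
    unfolding atlas_topology_def by (simp add: topology_inverse')
qed

definition smooth_manifold :: "('p, 'v::euclidean_space) chart set \<Rightarrow> bool" where
  "smooth_manifold A \<longleftrightarrow> smooth_atlas A \<and>
     Hausdorff_space (atlas_topology A) \<and> second_countable (atlas_topology A)"


section \<open>Smooth functions, vector fields and linear connections\<close>

definition smooth_function ::
  "('p, 'v::euclidean_space) chart set \<Rightarrow> 'p set \<Rightarrow> ('p \<Rightarrow> 'b::real_normed_vector) \<Rightarrow> bool" where
  "smooth_function A W f \<longleftrightarrow>
     (\<forall>c\<in>A. smooth_on (snd c ` (W \<inter> fst c)) (f \<circ> inv_into (fst c) (snd c)))"

text \<open>The Jacobian at \<open>p\<close> of the change of coordinates from \<open>c\<close> to \<open>c'\<close>.\<close>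

definition jacobian ::
  "('p, 'v::euclidean_space) chart \<Rightarrow> ('p, 'v) chart \<Rightarrow> 'p \<Rightarrow> 'v \<Rightarrow> 'v" where
  "jacobian c c' p = frechet_derivative (transition c c') (at (snd c p))"

text \<open>
  A tangent vector at a point is the family of its components in all charts around the point,
  related by the Jacobians. A vector field \<open>X\<close> on an open set \<open>W\<close> thus has components \<open>X p c\<close>;
  these are set to zero where they are meaningless, so that equality of fields is equality of
  functions.
\<close>

type_synonym ('p, 'v) field = "'p \<Rightarrow> ('p, 'v) chart \<Rightarrow> 'v"

definition vector_fields ::
  "('p, 'v::euclidean_space) chart set \<Rightarrow> 'p set \<Rightarrow> ('p, 'v) field set" where
  "vector_fields A W = {X.
     (\<forall>p c. \<not> (c \<in> A \<and> p \<in> W \<inter> fst c) \<longrightarrow> X p c = 0) \<and>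
     (\<forall>c\<in>A. \<forall>c'\<in>A. \<forall>p \<in> W \<inter> fst c \<inter> fst c'. X p c' = jacobian c c' p (X p c)) \<and>
     (\<forall>c\<in>A. smooth_on (snd c ` (W \<inter> fst c)) ((\<lambda>p. X p c) \<circ> inv_into (fst c) (snd c)))}"

text \<open>The field on \<open>W \<subseteq> fst c\<close> whose components in the chart \<open>c\<close> are \<open>f\<close>.\<close>

definition field_from_chart ::
  "('p, 'v::euclidean_space) chart set \<Rightarrow> 'p set \<Rightarrow> ('p, 'v) chart \<Rightarrow> ('p \<Rightarrow> 'v) \<Rightarrow> ('p, 'v) field" where
  "field_from_chart A W c f =
     (\<lambda>p c'. if c' \<in> A \<and> p \<in> W \<inter> fst c' then jacobian c c' p (f p) else 0)"

definition field_restrict :: "'p set \<Rightarrow> ('p, 'v::euclidean_space) field \<Rightarrow> ('p, 'v) field" where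
  "field_restrict V X = (\<lambda>p c. if p \<in> V then X p c else 0)"

text \<open>\<open>X(f)\<close> at \<open>p\<close>, computed in the chart \<open>c\<close> around \<open>p\<close>.\<close>

definition field_action ::
  "('p, 'v::euclidean_space) chart \<Rightarrow> ('p, 'v) field \<Rightarrow> ('p \<Rightarrow> 'b::real_normed_vector) \<Rightarrow> 'p \<Rightarrow> 'b" where
  "field_action c X f p =
     frechet_derivative (f \<circ> inv_into (fst c) (snd c)) (at (snd c p)) (X p c)"

definition lie_bracket ::
  "('p, 'v::euclidean_space) chart set \<Rightarrow> 'p set \<Rightarrow> ('p, 'v) field \<Rightarrow> ('p, 'v) field \<Rightarrow> ('p, 'v) field" where
  "lie_bracket A W X Y = (\<lambda>p c. if c \<in> A \<and> p \<in> W \<inter> fst c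
     then field_action c X (\<lambda>q. Y q c) p - field_action c Y (\<lambda>q. X q c) p else 0)"

text \<open>
  A linear connection acts on local vector fields: \<open>\<nabla> W X Y\<close> is \<open>\<nabla>\<^sub>X Y\<close> for vector fields \<open>X\<close>, \<open>Y\<close>
  on the open set \<open>W\<close>, compatibly with restriction to smaller open sets. Real linearity in
  \<open>Y\<close> is the Leibniz rule for constant functions together with additivity.
\<close>

type_synonym ('p, 'v) connection =
  "'p set \<Rightarrow> ('p, 'v) field \<Rightarrow> ('p, 'v) field \<Rightarrow> ('p, 'v) field"

definition linear_connection ::
  "('p, 'v::euclidean_space) chart set \<Rightarrow> ('p, 'v) connection \<Rightarrow> bool" where
  "linear_connection A nabla \<longleftrightarrow> (\<forall>W. openin (atlas_topology A) W \<longrightarrow>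
     (\<forall>X\<in>vector_fields A W. \<forall>Y\<in>vector_fields A W. nabla W X Y \<in> vector_fields A W) \<and>
     (\<forall>X\<in>vector_fields A W. \<forall>X'\<in>vector_fields A W. \<forall>Y\<in>vector_fields A W.
        nabla W (\<lambda>p c. X p c + X' p c) Y = (\<lambda>p c. nabla W X Y p c + nabla W X' Y p c)) \<and>
     (\<forall>X\<in>vector_fields A W. \<forall>Y\<in>vector_fields A W. \<forall>Y'\<in>vector_fields A W.
        nabla W X (\<lambda>p c. Y p c + Y' p c) = (\<lambda>p c. nabla W X Y p c + nabla W X Y' p c)) \<and>
     (\<forall>f::'p \<Rightarrow> real. smooth_function A W f \<longrightarrow>
        (\<forall>X\<in>vector_fields A W. \<forall>Y\<in>vector_fields A W.
           nabla W (\<lambda>p c. f p *\<^sub>R X p c) Y = (\<lambda>p c. f p *\<^sub>R nabla W X Y p c) \<and>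
           (\<forall>c\<in>A. \<forall>p \<in> W \<inter> fst c. nabla W X (\<lambda>p c. f p *\<^sub>R Y p c) p c =
              field_action c X f p *\<^sub>R Y p c + f p *\<^sub>R nabla W X Y p c))) \<and>
     (\<forall>V. openin (atlas_topology A) V \<and> V \<subseteq> W \<longrightarrow>
        (\<forall>X\<in>vector_fields A W. \<forall>Y\<in>vector_fields A W.
           nabla V (field_restrict V X) (field_restrict V Y) = field_restrict V (nabla W X Y))))"

definition curvature ::
  "('p, 'v::euclidean_space) chart set \<Rightarrow> ('p, 'v) connection \<Rightarrow> 'p set \<Rightarrow>
   ('p, 'v) field \<Rightarrow> ('p, 'v) field \<Rightarrow> ('p, 'v) field \<Rightarrow> ('p, 'v) field" where
  "curvature A nabla W X Y Z = (\<lambda>p c. nabla W X (nabla W Y Z) p c - nabla W Y (nabla W X Z) p c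
     - nabla W (lie_bracket A W X Y) Z p c)"


section \<open>The 1-jet space \<open>J\<^sup>1(\<real>, M)\<close>\<close>

text \<open>The charts of the time manifold: all those compatible with the standard coordinate.\<close>

definition time_charts :: "(real, real) chart set" where
  "time_charts = {c. smooth_atlas {(UNIV, id), c}}"

definition smooth_curve_at ::
  "('m, real^'n) chart set \<Rightarrow> real \<Rightarrow> (real \<Rightarrow> 'm) \<Rightarrow> bool" where
  "smooth_curve_at A t \<gamma> \<longleftrightarrow>
     (\<exists>c\<in>A. \<exists>I. open I \<and> t \<in> I \<and> \<gamma> ` I \<subseteq> fst c \<and> smooth_on I (snd c \<circ> \<gamma>))"

text \<open>Two pairs of a time and a curve are related if they have the same 1-jet.\<close>

definition jet_rel ::
  "('m, real^'n) chart set \<Rightarrow> ((real \<times> (real \<Rightarrow> 'm)) \<times> (real \<times> (real \<Rightarrow> 'm))) set" where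
  "jet_rel A = {((t, \<gamma>), (s, \<sigma>)). smooth_curve_at A t \<gamma> \<and> smooth_curve_at A s \<sigma> \<and>
     t = s \<and> \<gamma> t = \<sigma> t \<and>
     (\<forall>c\<in>A. \<gamma> t \<in> fst c \<longrightarrow>
        vector_derivative (snd c \<circ> \<gamma>) (at t) = vector_derivative (snd c \<circ> \<sigma>) (at t))}"

type_synonym 'm jet = "(real \<times> (real \<Rightarrow> 'm)) set"

definition jet_space :: "('m, real^'n) chart set \<Rightarrow> 'm jet set" where
  "jet_space A = {(t, \<gamma>). smooth_curve_at A t \<gamma>} // jet_rel A"

text \<open>
  The coordinates \<open>(t, x, y)\<close> of a jet induced by a chart of the time manifold and a chart of
  \<open>M\<close>; \<open>y\<close> is the derivative of the coordinate expression of the curve with respect to the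
  chosen time coordinate. All representatives of a jet give the same coordinates.
\<close>

type_synonym 'n jet_model = "real \<times> (real^'n) \<times> (real^'n)"

definition jet_chart ::
  "('m, real^'n) chart set \<Rightarrow> (real, real) chart \<Rightarrow> ('m, real^'n) chart \<Rightarrow> ('m jet, 'n jet_model) chart" where
  "jet_chart A c d =
     ({e \<in> jet_space A. \<forall>(t, \<gamma>)\<in>e. t \<in> fst c \<and> \<gamma> t \<in> fst d},
      \<lambda>e. let (t, \<gamma>) = (SOME r. r \<in> e) in
        (snd c t, snd d (\<gamma> t),
         vector_derivative (snd d \<circ> \<gamma> \<circ> inv_into (fst c) (snd c)) (at (snd c t))))"

definition jet_atlas :: "('m, real^'n) chart set \<Rightarrow> ('m jet, 'n jet_model) chart set" where
  "jet_atlas A = {jet_chart A c d | c d. c \<in> time_charts \<and> d \<in> A}"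

definition jet_y :: "('m jet, 'n::finite jet_model) chart \<Rightarrow> 'm jet \<Rightarrow> 'n \<Rightarrow> real" where
  "jet_y \<Phi> e i = snd (snd (snd \<Phi> e)) $ i"


section \<open>Nonlinear connections and the adapted basis\<close>

text \<open>
  A nonlinear connection \<open>\<Gamma>\<close> assigns to each chart \<open>\<Phi>\<close> of the jet space the local functions
  \<open>M\<^sup>k\<close> as \<open>nlc_M \<Gamma> \<Phi> e $ k\<close> and \<open>N\<^sup>k\<^sub>l\<close> as \<open>nlc_N \<Gamma> \<Phi> e $ k $ l\<close>.
\<close>

type_synonym ('m, 'n) nonlin_conn =
  "(('m jet, 'n jet_model) chart \<Rightarrow> 'm jet \<Rightarrow> real^'n) \<times>
   (('m jet, 'n jet_model) chart \<Rightarrow> 'm jet \<Rightarrow> real^'n^'n)"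

abbreviation nlc_M :: "('m, 'n) nonlin_conn \<Rightarrow> ('m jet, 'n jet_model) chart \<Rightarrow> 'm jet \<Rightarrow> real^'n" where
  "nlc_M \<Gamma> \<equiv> fst \<Gamma>"

abbreviation nlc_N :: "('m, 'n) nonlin_conn \<Rightarrow> ('m jet, 'n jet_model) chart \<Rightarrow> 'm jet \<Rightarrow> real^'n^'n" where
  "nlc_N \<Gamma> \<equiv> snd \<Gamma>"

text \<open>
  The partial derivatives of the new coordinates (chart \<open>\<Psi>\<close>) with respect to the old ones
  (chart \<open>\<Phi>\<close>) at the jet \<open>e\<close>. The derivatives of the old coordinates with respect to the new
  ones are obtained by exchanging \<open>\<Phi>\<close> and \<open>\<Psi>\<close>.
\<close>

definition dt_dt :: "('m jet, 'n::finite jet_model) chart \<Rightarrow> ('m jet, 'n jet_model) chart \<Rightarrow> 'm jet \<Rightarrow> real" where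
  "dt_dt \<Phi> \<Psi> e = fst (jacobian \<Phi> \<Psi> e (1, 0, 0))"

definition dx_dx ::
  "('m jet, 'n::finite jet_model) chart \<Rightarrow> ('m jet, 'n jet_model) chart \<Rightarrow> 'm jet \<Rightarrow> 'n \<Rightarrow> 'n \<Rightarrow> real" where
  "dx_dx \<Phi> \<Psi> e k j = fst (snd (jacobian \<Phi> \<Psi> e (0, axis j 1, 0))) $ k"

definition dy_dt ::
  "('m jet, 'n::finite jet_model) chart \<Rightarrow> ('m jet, 'n jet_model) chart \<Rightarrow> 'm jet \<Rightarrow> 'n \<Rightarrow> real" where
  "dy_dt \<Phi> \<Psi> e k = snd (snd (jacobian \<Phi> \<Psi> e (1, 0, 0))) $ k"

definition dy_dx ::
  "('m jet, 'n::finite jet_model) chart \<Rightarrow> ('m jet, 'n jet_model) chart \<Rightarrow> 'm jet \<Rightarrow> 'n \<Rightarrow> 'n \<Rightarrow> real" where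
  "dy_dx \<Phi> \<Psi> e k i = snd (snd (jacobian \<Phi> \<Psi> e (0, axis i 1, 0))) $ k"

definition nonlinear_connection ::
  "('m, real^'n::finite) chart set \<Rightarrow> ('m, 'n) nonlin_conn \<Rightarrow> bool" where
  "nonlinear_connection A \<Gamma> \<longleftrightarrow>
     (\<forall>\<Phi>\<in>jet_atlas A.
        smooth_on (snd \<Phi> ` fst \<Phi>) (nlc_M \<Gamma> \<Phi> \<circ> inv_into (fst \<Phi>) (snd \<Phi>)) \<and>
        smooth_on (snd \<Phi> ` fst \<Phi>) (nlc_N \<Gamma> \<Phi> \<circ> inv_into (fst \<Phi>) (snd \<Phi>))) \<and>
     (\<forall>\<Phi>\<in>jet_atlas A. \<forall>\<Psi>\<in>jet_atlas A. \<forall>e \<in> fst \<Phi> \<inter> fst \<Psi>.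
        (\<forall>k. nlc_M \<Gamma> \<Psi> e $ k =
           (\<Sum>j\<in>UNIV. nlc_M \<Gamma> \<Phi> e $ j * (dt_dt \<Psi> \<Phi> e)\<^sup>2 * dx_dx \<Phi> \<Psi> e k j)
           - dt_dt \<Psi> \<Phi> e * dy_dt \<Phi> \<Psi> e k) \<and>
        (\<forall>k l. nlc_N \<Gamma> \<Psi> e $ k $ l =
           (\<Sum>i\<in>UNIV. \<Sum>j\<in>UNIV.
              nlc_N \<Gamma> \<Phi> e $ j $ i * dt_dt \<Psi> \<Phi> e * dx_dx \<Psi> \<Phi> e i l * dx_dx \<Phi> \<Psi> e k j)
           - (\<Sum>i\<in>UNIV. dx_dx \<Psi> \<Phi> e i l * dy_dx \<Phi> \<Psi> e k i)))"

text \<open>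
  Adapted indices: \<open>T\<close> is the time index \<open>1\<close>, \<open>H i\<close> the spatial index \<open>i\<close>, and \<open>V i\<close> stands for
  the pair of \<open>(i)\<close> and \<open>(1)\<close>.
\<close>

datatype 'n adapted_index = T | H 'n | V 'n

fun index_block :: "'n adapted_index \<Rightarrow> 'n adapted_index set" where
  "index_block T = {T}"
| "index_block (H i) = range H"
| "index_block (V i) = range V"

text \<open>The vectors \<open>\<delta>/\<delta>t\<close>, \<open>\<delta>/\<delta>x\<^sup>i\<close>, \<open>\<partial>/\<partial>y\<^sup>i\<close> in the coordinates of the chart \<open>\<Phi>\<close>.\<close>

fun adapted_vec ::
  "('m, 'n::finite) nonlin_conn \<Rightarrow> ('m jet, 'n jet_model) chart \<Rightarrow> 'm jet \<Rightarrow> 'n adapted_index \<Rightarrow> 'n jet_model" where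
  "adapted_vec \<Gamma> \<Phi> e T = (1, 0, - nlc_M \<Gamma> \<Phi> e)"
| "adapted_vec \<Gamma> \<Phi> e (H i) = (0, axis i 1, - (\<chi> j. nlc_N \<Gamma> \<Phi> e $ j $ i))"
| "adapted_vec \<Gamma> \<Phi> e (V i) = (0, 0, axis i 1)"

text \<open>
  The components of the vector \<open>w\<close> (given in the coordinates of \<open>\<Phi>\<close>) with respect to the
  adapted basis.
\<close>

fun adapted_comp ::
  "('m, 'n::finite) nonlin_conn \<Rightarrow> ('m jet, 'n jet_model) chart \<Rightarrow> 'm jet \<Rightarrow> 'n adapted_index \<Rightarrow> 'n jet_model \<Rightarrow> real" where
  "adapted_comp \<Gamma> \<Phi> e T w = fst w"
| "adapted_comp \<Gamma> \<Phi> e (H i) w = fst (snd w) $ i"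
| "adapted_comp \<Gamma> \<Phi> e (V i) w =
     snd (snd w) $ i + nlc_M \<Gamma> \<Phi> e $ i * fst w + (\<Sum>j\<in>UNIV. nlc_N \<Gamma> \<Phi> e $ i $ j * fst (snd w) $ j)"

lemma adapted_expansion:
  fixes w :: "'n::finite jet_model"
  shows "w = (\<Sum>a\<in>{T} \<union> range H \<union> range V. adapted_comp \<Gamma> \<Phi> e a w *\<^sub>R adapted_vec \<Gamma> \<Phi> e a)"
proof -
  let ?f = "\<lambda>a. adapted_comp \<Gamma> \<Phi> e a w *\<^sub>R adapted_vec \<Gamma> \<Phi> e a"
  have ax: "(\<Sum>i\<in>UNIV. x i * axis i 1 $ k) = x k" "(\<Sum>i\<in>UNIV. x i *\<^sub>R axis i 1 $ k) = x k"
    for x :: "'n \<Rightarrow> real" and k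
    by (simp_all add: axis_def if_distrib cong: if_cong)
  have "sum ?f ({T} \<union> range H \<union> range V) = ?f T + sum ?f (range H) + sum ?f (range V)"
    by (subst sum.union_disjoint; (subst sum.union_disjoint)?; auto)
  also have "sum ?f (range H) = (\<Sum>i\<in>UNIV. ?f (H i))"
    by (subst sum.reindex) (auto simp: inj_on_def)
  also have "sum ?f (range V) = (\<Sum>i\<in>UNIV. ?f (V i))"
    by (subst sum.reindex) (auto simp: inj_on_def)
  finally have *: "sum ?f ({T} \<union> range H \<union> range V) = ?f T + (\<Sum>i\<in>UNIV. ?f (H i)) + (\<Sum>i\<in>UNIV. ?f (V i))" .
  show ?thesis
    unfolding * by (simp add: prod_eq_iff vec_eq_iff fst_sum snd_sum ax sum_negf)
      (simp add: algebra_simps)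
qed

text \<open>The adapted basis as local vector fields on the domain of \<open>\<Phi>\<close>.\<close>

definition adapted_field ::
  "('m, real^'n::finite) chart set \<Rightarrow> ('m, 'n) nonlin_conn \<Rightarrow> ('m jet, 'n jet_model) chart \<Rightarrow>
   'n adapted_index \<Rightarrow> ('m jet, 'n jet_model) field" where
  "adapted_field A \<Gamma> \<Phi> a = field_from_chart (jet_atlas A) (fst \<Phi>) \<Phi> (\<lambda>e. adapted_vec \<Gamma> \<Phi> e a)"

text \<open>
  The projection of fields on \<open>W\<close> onto the summand locally spanned by the adapted basis vectors
  with index in \<open>B\<close>. The choices \<open>{T}\<close>, \<open>range H\<close>, \<open>range V\<close> for \<open>B\<close> give \<open>h\<^sub>\<real>\<close>, \<open>h\<^sub>M\<close>, \<open>v\<close>.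
\<close>

definition adapted_proj ::
  "('m, real^'n::finite) chart set \<Rightarrow> ('m, 'n) nonlin_conn \<Rightarrow> 'n adapted_index set \<Rightarrow> 'm jet set \<Rightarrow>
   ('m jet, 'n jet_model) field \<Rightarrow> ('m jet, 'n jet_model) field" where
  "adapted_proj A \<Gamma> B W X = (\<lambda>e \<Phi>. if \<Phi> \<in> jet_atlas A \<and> e \<in> W \<inter> fst \<Phi>
     then (\<Sum>a\<in>B. adapted_comp \<Gamma> \<Phi> e a (X e \<Phi>) *\<^sub>R adapted_vec \<Gamma> \<Phi> e a) else 0)"


section \<open>\<open>\<Gamma>\<close>-linear connections\<close>

definition Gamma_linear_connection ::
  "('m, real^'n::finite) chart set \<Rightarrow> ('m, 'n) nonlin_conn \<Rightarrow> ('m jet, 'n jet_model) connection \<Rightarrow> bool" where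
  "Gamma_linear_connection A \<Gamma> nabla \<longleftrightarrow> linear_connection (jet_atlas A) nabla \<and>
     (\<forall>B \<in> {{T}, range H, range V}. \<forall>W. openin (atlas_topology (jet_atlas A)) W \<longrightarrow>
        (\<forall>X\<in>vector_fields (jet_atlas A) W. \<forall>Y\<in>vector_fields (jet_atlas A) W.
           nabla W X (adapted_proj A \<Gamma> B W Y) = adapted_proj A \<Gamma> B W (nabla W X Y)))"

text \<open>
  \<open>adapted_coeff A \<Gamma> nabla \<Phi> c b a\<close> is the coefficient of the basis field with index \<open>c\<close> in the
  covariant derivative of the one with index \<open>b\<close> along the one with index \<open>a\<close>. The coefficients
  with \<open>c\<close> and \<open>b\<close> in different blocks vanish for a \<open>\<Gamma>\<close>-linear connection. With \<open>a = T\<close> the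
  others are \<open>G\<close>-coefficients, with \<open>a = H j\<close> they are \<open>L\<close>-coefficients and with \<open>a = V j\<close> they
  are \<open>C\<close>-coefficients; those with \<open>c = b = T\<close> carry the bar.
\<close>

definition adapted_coeff ::
  "('m, real^'n::finite) chart set \<Rightarrow> ('m, 'n) nonlin_conn \<Rightarrow> ('m jet, 'n jet_model) connection \<Rightarrow>
   ('m jet, 'n jet_model) chart \<Rightarrow>
   'n adapted_index \<Rightarrow> 'n adapted_index \<Rightarrow> 'n adapted_index \<Rightarrow> 'm jet \<Rightarrow> real" where
  "adapted_coeff A \<Gamma> nabla \<Phi> c b a e = adapted_comp \<Gamma> \<Phi> e c
     (nabla (fst \<Phi>) (adapted_field A \<Gamma> \<Phi> a) (adapted_field A \<Gamma> \<Phi> b) e \<Phi>)"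

text \<open>
  \<open>vert_curv A \<Gamma> nabla \<Phi> l i a b\<close> is the coefficient of \<open>\<partial>/\<partial>y\<^sup>l\<close> in \<open>R(X, Y)(\<partial>/\<partial>y\<^sup>i)\<close>, where
  \<open>X\<close> and \<open>Y\<close> are the basis fields with indices \<open>b\<close> and \<open>a\<close>, in this order.
\<close>

definition vert_curv ::
  "('m, real^'n::finite) chart set \<Rightarrow> ('m, 'n) nonlin_conn \<Rightarrow> ('m jet, 'n jet_model) connection \<Rightarrow>
   ('m jet, 'n jet_model) chart \<Rightarrow>
   'n \<Rightarrow> 'n \<Rightarrow> 'n adapted_index \<Rightarrow> 'n adapted_index \<Rightarrow> 'm jet \<Rightarrow> real" where
  "vert_curv A \<Gamma> nabla \<Phi> l i a b e = adapted_comp \<Gamma> \<Phi> e (V l)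
     (curvature (jet_atlas A) nabla (fst \<Phi>) (adapted_field A \<Gamma> \<Phi> b) (adapted_field A \<Gamma> \<Phi> a)
        (adapted_field A \<Gamma> \<Phi> (V i)) e \<Phi>)"

definition adapted_deriv ::
  "('m, real^'n::finite) chart set \<Rightarrow> ('m, 'n) nonlin_conn \<Rightarrow> ('m jet, 'n jet_model) chart \<Rightarrow>
   'n adapted_index \<Rightarrow> ('m jet \<Rightarrow> real) \<Rightarrow> 'm jet \<Rightarrow> real" where
  "adapted_deriv A \<Gamma> \<Phi> a f = field_action \<Phi> (adapted_field A \<Gamma> \<Phi> a) f"


subsection \<open>Torsion d-tensors\<close>

text \<open>
  The arguments are the upper index followed by the lower ones. A name ending in 1 marks the
  tensors with a time index as first lower index, which is then not an argument.
\<close>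

definition tors_Tbar where
  "tors_Tbar A \<Gamma> nabla \<Phi> j e = adapted_coeff A \<Gamma> nabla \<Phi> T T (H j) e"

definition tors_T1 where
  "tors_T1 A \<Gamma> nabla \<Phi> r j e = - adapted_coeff A \<Gamma> nabla \<Phi> (H r) (H j) T e"

definition tors_T where
  "tors_T A \<Gamma> nabla \<Phi> r i j e =
     adapted_coeff A \<Gamma> nabla \<Phi> (H r) (H i) (H j) e - adapted_coeff A \<Gamma> nabla \<Phi> (H r) (H j) (H i) e"

definition tors_S where
  "tors_S A \<Gamma> nabla \<Phi> r i j e =
     adapted_coeff A \<Gamma> nabla \<Phi> (V r) (V i) (V j) e - adapted_coeff A \<Gamma> nabla \<Phi> (V r) (V j) (V i) e"

definition tors_P1 where
  "tors_P1 A \<Gamma> nabla \<Phi> r j e =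
     adapted_deriv A \<Gamma> \<Phi> (V j) (\<lambda>q. nlc_M \<Gamma> \<Phi> q $ r) e - adapted_coeff A \<Gamma> nabla \<Phi> (V r) (V j) T e"

definition tors_P where
  "tors_P A \<Gamma> nabla \<Phi> r i j e =
     adapted_deriv A \<Gamma> \<Phi> (V j) (\<lambda>q. nlc_N \<Gamma> \<Phi> q $ r $ i) e
     - adapted_coeff A \<Gamma> nabla \<Phi> (V r) (V j) (H i) e"

definition tors_R1 where
  "tors_R1 A \<Gamma> \<Phi> r j e =
     adapted_deriv A \<Gamma> \<Phi> (H j) (\<lambda>q. nlc_M \<Gamma> \<Phi> q $ r) e
     - adapted_deriv A \<Gamma> \<Phi> T (\<lambda>q. nlc_N \<Gamma> \<Phi> q $ r $ j) e"

definition tors_R where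
  "tors_R A \<Gamma> \<Phi> r i j e =
     adapted_deriv A \<Gamma> \<Phi> (H j) (\<lambda>q. nlc_N \<Gamma> \<Phi> q $ r $ i) e
     - adapted_deriv A \<Gamma> \<Phi> (H i) (\<lambda>q. nlc_N \<Gamma> \<Phi> q $ r $ j) e"


subsection \<open>Covariant derivatives and deflection d-tensors\<close>

text \<open>
  A d-tensor is given in a chart by its components, which depend on the list of contravariant
  and the list of covariant adapted indices.
\<close>

type_synonym ('m, 'n) d_tensor = "'n adapted_index list \<Rightarrow> 'n adapted_index list \<Rightarrow> 'm jet \<Rightarrow> real"

text \<open>
  The derivative indices \<open>T\<close>, \<open>H p\<close>, \<open>V p\<close> give the three covariant derivatives \<open>/1\<close>, \<open>|p\<close> and
  \<open>|(p)\<close>. Every index contributes a sum over the indices of its own block, which for a time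
  index is a single term.
\<close>

definition cov_deriv ::
  "('m, real^'n::finite) chart set \<Rightarrow> ('m, 'n) nonlin_conn \<Rightarrow> ('m jet, 'n jet_model) connection \<Rightarrow>
   ('m jet, 'n jet_model) chart \<Rightarrow> 'n adapted_index \<Rightarrow> ('m, 'n) d_tensor \<Rightarrow> ('m, 'n) d_tensor" where
  "cov_deriv A \<Gamma> nabla \<Phi> a D us ls e =
     adapted_deriv A \<Gamma> \<Phi> a (D us ls) e
     + (\<Sum>m<length us. \<Sum>r\<in>index_block (us ! m).
          D (us[m := r]) ls e * adapted_coeff A \<Gamma> nabla \<Phi> (us ! m) r a e)
     - (\<Sum>m<length ls. \<Sum>r\<in>index_block (ls ! m).
          D us (ls[m := r]) e * adapted_coeff A \<Gamma> nabla \<Phi> r (ls ! m) a e)"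

definition liouville :: "('m jet, 'n::finite jet_model) chart \<Rightarrow> ('m, 'n) d_tensor" where
  "liouville \<Phi> us ls e = (case (us, ls) of ([V i], []) \<Rightarrow> jet_y \<Phi> e i | _ \<Rightarrow> 0)"

text \<open>
  The deflection d-tensors have one vertical contravariant index \<open>V i\<close> and one covariant index,
  which is the derivative index of the covariant derivative of the Liouville field. It is \<open>T\<close>
  for the first, \<open>H j\<close> for the second and \<open>V j\<close> for the third of them.
\<close>

definition deflection ::
  "('m, real^'n::finite) chart set \<Rightarrow> ('m, 'n) nonlin_conn \<Rightarrow> ('m jet, 'n jet_model) connection \<Rightarrow>
   ('m jet, 'n jet_model) chart \<Rightarrow> ('m, 'n) d_tensor" where
  "deflection A \<Gamma> nabla \<Phi> us ls =
     (case ls of [a] \<Rightarrow> cov_deriv A \<Gamma> nabla \<Phi> a (liouville \<Phi>) us [] | _ \<Rightarrow> (\<lambda>e. 0))"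

definition defl_Dbar where
  "defl_Dbar A \<Gamma> nabla \<Phi> i = deflection A \<Gamma> nabla \<Phi> [V i] [T]"

definition defl_D where
  "defl_D A \<Gamma> nabla \<Phi> i j = deflection A \<Gamma> nabla \<Phi> [V i] [H j]"

definition defl_d where
  "defl_d A \<Gamma> nabla \<Phi> i j = deflection A \<Gamma> nabla \<Phi> [V i] [V j]"

text \<open>The covariant derivatives of the deflection d-tensors along the adapted index \<open>a\<close>.\<close>

definition defl_Dbar_cov where
  "defl_Dbar_cov A \<Gamma> nabla \<Phi> i a = cov_deriv A \<Gamma> nabla \<Phi> a (deflection A \<Gamma> nabla \<Phi>) [V i] [T]"

definition defl_D_cov where
  "defl_D_cov A \<Gamma> nabla \<Phi> i j a = cov_deriv A \<Gamma> nabla \<Phi> a (deflection A \<Gamma> nabla \<Phi>) [V i] [H j]"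

definition defl_d_cov where
  "defl_d_cov A \<Gamma> nabla \<Phi> i j a = cov_deriv A \<Gamma> nabla \<Phi> a (deflection A \<Gamma> nabla \<Phi>) [V i] [V j]"

end

theory Submission
  imports Defs
begin

text \<open>
  All five identities are instances of the Ricci identity
  \<open>\<nabla>\<^sub>b \<nabla>\<^sub>a \<C> - \<nabla>\<^sub>a \<nabla>\<^sub>b \<C> = R(E\<^sub>b, E\<^sub>a) \<C> + \<nabla>\<^bsub>[E\<^sub>b, E\<^sub>a]\<^esub> \<C>\<close>
  for the Liouville field \<open>\<C> = y\<^sup>r \<partial>/\<partial>y\<^sup>r\<close> and two fields \<open>E\<^sub>a\<close>, \<open>E\<^sub>b\<close> of the adapted basis. The deflection
  tensors are the components \<open>D\<^sub>a\<close> of \<open>\<nabla>\<^sub>a \<C>\<close>. Their covariant derivatives differ from the components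
  of \<open>\<nabla>\<^sub>b \<nabla>\<^sub>a \<C>\<close> only by the terms for the covariant index \<open>a\<close>, which contract \<open>D\<close> with the
  coefficients of \<open>\<nabla>\<^sub>b E\<^sub>a\<close>. The bracket \<open>[E\<^sub>b, E\<^sub>a]\<close> is vertical, because the time and position
  components of the adapted basis are constant, so \<open>\<nabla>\<close> along it is the contraction of the bracket
  components with the vertical deflection tensor. The bracket components together with the
  coefficients of \<open>\<nabla>\<^sub>b E\<^sub>a\<close> and \<open>\<nabla>\<^sub>a E\<^sub>b\<close> make up the torsion tensors and the \<open>C\<close> coefficients of the
  right-hand sides. The identity for arbitrary index pairs is
  \<open>deflection_identity\<close>; the theorem evaluates the brackets for the five kinds of pairs.

  The computation takes place in one chart, but the curvature applies the connection to fields such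
  as \<open>\<nabla>\<^sub>a (\<partial>/\<partial>y\<^sup>r)\<close> and \<open>[E\<^sub>b, E\<^sub>a]\<close>. To insert their expansions into the connection one has
  to know that these are smooth fields which agree in all charts. This rests on three facts: the
  jet charts form a smooth atlas (\<open>smooth_jet_atlas\<close>), the Lie bracket transforms like a vector
  field (\<open>lie_bracket_in_vector_fields\<close>, by symmetry of second derivatives), and the covariant
  derivative of a vertical field is vertical (\<open>nabla_vertical_field\<close>, from \<open>\<nabla>v = 0\<close> and the
  invariance of vertical vectors under changes of jet coordinates).
\<close>

section \<open>Calculus of smooth maps\<close>

lemma has_derivative_cong_open:
  assumes "open S" "x \<in> S" "\<And>y. y \<in> S \<Longrightarrow> f y = g y"
  shows "(f has_derivative f') (at x) \<longleftrightarrow> (g has_derivative f') (at x)"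
  using has_derivative_transform_within_open[of f f' x UNIV S g, OF _ assms]
    has_derivative_transform_within_open[of g f' x UNIV S f, OF _ assms(1,2) assms(3)[symmetric]]
  by blast

lemma frechet_derivative_cong_open:
  assumes "open S" "x \<in> S" "\<And>y. y \<in> S \<Longrightarrow> f y = g y"
  shows "frechet_derivative f (at x) = frechet_derivative g (at x)"
  by (simp only: frechet_derivative_def has_derivative_cong_open[of S x f g, OF assms])

lemma differentiable_cong_open:
  assumes "open S" "x \<in> S" "\<And>y. y \<in> S \<Longrightarrow> f y = g y"
  shows "f differentiable (at x) \<longleftrightarrow> g differentiable (at x)"
  by (simp only: differentiable_def has_derivative_cong_open[of S x f g, OF assms])

lemma Ck_on_cong:
  assumes "open S" "\<And>x. x \<in> S \<Longrightarrow> f x = g x"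
  shows "Ck_on k S f \<longleftrightarrow> Ck_on k S g"
  using assms(2)
proof (induction k arbitrary: f g)
  case 0
  then show ?case by (simp cong: continuous_on_cong)
next
  case (Suc k)
  have "Ck_on k S (\<lambda>x. frechet_derivative f (at x) v) \<longleftrightarrow>
        Ck_on k S (\<lambda>x. frechet_derivative g (at x) v)" for v
    by (rule Suc.IH) (simp only: frechet_derivative_cong_open[OF assms(1) _ Suc.prems])
  moreover have "f differentiable (at x) \<longleftrightarrow> g differentiable (at x)" if "x \<in> S" for x
    by (rule differentiable_cong_open[OF assms(1) that Suc.prems])
  ultimately show ?case by simp
qed

text \<open>
  The derivatives produced by the differentiation rules do not have the form required by
  \<^const>\<open>Ck_on\<close>; derivatives are unique, so any derivative will do.
\<close>

lemma Ck_on_SucI: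
  assumes "open S" "\<And>x. x \<in> S \<Longrightarrow> (f has_derivative f' x) (at x)"
    and "\<And>v. Ck_on k S (\<lambda>x. f' x v)"
  shows "Ck_on (Suc k) S f"
proof -
  have "Ck_on k S (\<lambda>x. frechet_derivative f (at x) v)" for v
  proof -
    have "f' x v = frechet_derivative f (at x) v" if "x \<in> S" for x
      by (simp only: frechet_derivative_at[OF assms(2)[OF that]])
    from Ck_on_cong[of S "\<lambda>x. f' x v" "\<lambda>x. frechet_derivative f (at x) v" k, OF assms(1) this] assms(3)[of v]
    show ?thesis by blast
  qed
  moreover have "f differentiable (at x)" if "x \<in> S" for x
    using assms(2)[OF that] unfolding differentiable_def by blast
  ultimately show ?thesis by simp
qed

lemma Ck_on_has_derivative:
  "Ck_on (Suc k) S f \<Longrightarrow> x \<in> S \<Longrightarrow> (f has_derivative frechet_derivative f (at x)) (at x)"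
  by (simp only: Ck_on.simps frechet_derivative_works[symmetric])

lemma Ck_on_SucD: "Ck_on (Suc k) S f \<Longrightarrow> Ck_on k S f"
proof (induction k arbitrary: f)
  case 0
  then show ?case
    by (auto intro: continuous_at_imp_continuous_on differentiable_imp_continuous_within)
next
  case (Suc k)
  then show ?case
    unfolding Ck_on.simps(2)[of "Suc k"] Ck_on.simps(2)[of k] by blast
qed

lemma Ck_on_subset: "Ck_on k S f \<Longrightarrow> U \<subseteq> S \<Longrightarrow> Ck_on k U f"
  by (induction k arbitrary: f) (auto intro: continuous_on_subset)

lemma Ck_on_const: "Ck_on k S (\<lambda>x. c)"
  by (induction k arbitrary: c) auto

lemma Ck_on_bounded_linear:
  assumes "bounded_linear h" "open S" "Ck_on k S f"
  shows "Ck_on k S (\<lambda>x. h (f x))"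
  using assms(3)
proof (induction k arbitrary: f)
  case 0
  then show ?case
    using assms(1) by (auto intro: bounded_linear.continuous_on)
next
  case (Suc k)
  show ?case
    by (rule Ck_on_SucI[OF assms(2) bounded_linear.has_derivative[OF assms(1)
            Ck_on_has_derivative[OF Suc.prems]]])
      (use Suc in auto)
qed

lemma Ck_on_add:
  assumes "open S" "Ck_on k S f" "Ck_on k S g"
  shows "Ck_on k S (\<lambda>x. f x + g x)"
  using assms(2,3)
proof (induction k arbitrary: f g)
  case 0
  then show ?case by (auto intro: continuous_on_add)
next
  case (Suc k)
  show ?case
    by (rule Ck_on_SucI[OF assms(1) has_derivative_add[OF
            Ck_on_has_derivative[OF Suc.prems(1)] Ck_on_has_derivative[OF Suc.prems(2)]]])
      (use Suc in auto)
qed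

lemma Ck_on_sum:
  assumes "open S" "\<And>i. i \<in> I \<Longrightarrow> Ck_on k S (f i)"
  shows "Ck_on k S (\<lambda>x. \<Sum>i\<in>I. f i x)"
  using assms(2)
  by (induction I rule: infinite_finite_induct) (auto intro: Ck_on_add[OF assms(1)] Ck_on_const)

lemma Ck_on_bounded_bilinear:
  assumes "bounded_bilinear h" "open S" "Ck_on k S f" "Ck_on k S g"
  shows "Ck_on k S (\<lambda>x. h (f x) (g x))"
  using assms(3,4)
proof (induction k arbitrary: f g)
  case 0
  then show ?case
    using assms(1) by (auto intro: bounded_bilinear.continuous_on)
next
  case (Suc k)
  show ?case
  proof (rule Ck_on_SucI[OF assms(2) bounded_bilinear.FDERIV[OF assms(1)
            Ck_on_has_derivative[OF Suc.prems(1)] Ck_on_has_derivative[OF Suc.prems(2)]]])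
    fix v
    show "Ck_on k S (\<lambda>x. h (f x) (frechet_derivative g (at x) v) + h (frechet_derivative f (at x) v) (g x))"
      using Suc.prems Suc.prems[THEN Ck_on_SucD] by (intro Ck_on_add assms Suc.IH) auto
  qed
qed

text \<open>
  Expanding directions in the standard basis is what turns statements about the derivatives in
  fixed directions, by which \<^const>\<open>Ck_on\<close> is defined, into statements about compositions and
  about derivatives along fields.
\<close>

lemma linear_eq_sum_Basis:
  fixes L :: "'a::euclidean_space \<Rightarrow> 'b::real_normed_vector"
  assumes "linear L"
  shows "L v = (\<Sum>b\<in>Basis. (v \<bullet> b) *\<^sub>R L b)"
proof -
  have "(\<Sum>b\<in>Basis. (v \<bullet> b) *\<^sub>R L b) = L (\<Sum>b\<in>Basis. (v \<bullet> b) *\<^sub>R b)"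
    by (simp only: linear_sum[OF assms] linear_scale[OF assms])
  then show ?thesis by (simp only: euclidean_representation)
qed

lemma Ck_on_compose:
  fixes f :: "'a::euclidean_space \<Rightarrow> 'b::euclidean_space"
    and g :: "'b \<Rightarrow> 'c::real_normed_vector"
  assumes "open S" "open U" "f ` S \<subseteq> U" "Ck_on k S f" "Ck_on k U g"
  shows "Ck_on k S (\<lambda>x. g (f x))"
  using assms(4,5)
proof (induction k arbitrary: g)
  case 0
  then show ?case
    using assms(3) continuous_on_compose2 by auto
next
  case (Suc k)
  note dg = Ck_on_has_derivative[OF Suc.prems(2)]
  have fU: "f x \<in> U" if "x \<in> S" for x using that assms(3) by auto
  show ?case
  proof (rule Ck_on_SucI[OF assms(1)])
    fix x assume x: "x \<in> S"
    have "((\<lambda>x. g (f x)) has_derivative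
            (\<lambda>v. frechet_derivative g (at (f x)) (frechet_derivative f (at x) v))) (at x)"
      using has_derivative_compose[OF Ck_on_has_derivative[OF Suc.prems(1) x] dg[OF fU[OF x]]] .
    moreover have "linear (frechet_derivative g (at (f x)))"
      using dg[OF fU[OF x]] has_derivative_linear by blast
    ultimately show "((\<lambda>x. g (f x)) has_derivative
        (\<lambda>v. \<Sum>b\<in>Basis. (frechet_derivative f (at x) v \<bullet> b) *\<^sub>R frechet_derivative g (at (f x)) b)) (at x)"
      by (simp flip: linear_eq_sum_Basis)
  next
    fix v
    show "Ck_on k S (\<lambda>x. \<Sum>b\<in>Basis. (frechet_derivative f (at x) v \<bullet> b) *\<^sub>R
                            frechet_derivative g (at (f x)) b)"
      using Suc.prems Ck_on_SucD[OF Suc.prems(1)]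
      by (intro Ck_on_sum Ck_on_bounded_bilinear[OF bounded_bilinear_scaleR] assms(1) Suc.IH
          Ck_on_bounded_linear[OF bounded_linear_inner_left]) auto
  qed
qed

lemma Ck_on_ident: "Ck_on k S (\<lambda>x. x)"
  by (cases k) (auto simp: Ck_on_const)

lemma smooth_on_cong: "open S \<Longrightarrow> (\<And>x. x \<in> S \<Longrightarrow> f x = g x) \<Longrightarrow> smooth_on S f \<longleftrightarrow> smooth_on S g"
  by (simp only: smooth_on_def Ck_on_cong[of S f g])

lemma smooth_on_transform:
  assumes "smooth_on S g" "open S" "\<And>x. x \<in> S \<Longrightarrow> f x = g x"
  shows "smooth_on S f"
  using assms(1) smooth_on_cong[of S f g, OF assms(2,3)] by blast

lemma smooth_on_subset: "smooth_on S f \<Longrightarrow> U \<subseteq> S \<Longrightarrow> smooth_on U f"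
  by (auto simp: smooth_on_def intro: Ck_on_subset)

lemma smooth_on_const: "smooth_on S (\<lambda>x. c)"
  by (auto simp: smooth_on_def Ck_on_const)

lemma smooth_on_ident: "smooth_on S (\<lambda>x. x)"
  by (auto simp: smooth_on_def Ck_on_ident)

lemma smooth_on_bounded_linear:
  "bounded_linear h \<Longrightarrow> open S \<Longrightarrow> smooth_on S f \<Longrightarrow> smooth_on S (\<lambda>x. h (f x))"
  unfolding smooth_on_def using Ck_on_bounded_linear[of h S _ f] by blast

lemma smooth_on_add:
  "open S \<Longrightarrow> smooth_on S f \<Longrightarrow> smooth_on S g \<Longrightarrow> smooth_on S (\<lambda>x. f x + g x)"
  unfolding smooth_on_def using Ck_on_add[of S _ f g] by blast

lemma smooth_on_diff:
  assumes "open S" "smooth_on S f" "smooth_on S g"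
  shows "smooth_on S (\<lambda>x. f x - g x)"
  using smooth_on_add[OF assms(1,2) smooth_on_bounded_linear[OF
        bounded_linear_minus[OF bounded_linear_ident] assms(1,3)]]
  by simp

lemma smooth_on_sum:
  "open S \<Longrightarrow> (\<And>i. i \<in> I \<Longrightarrow> smooth_on S (f i)) \<Longrightarrow> smooth_on S (\<lambda>x. \<Sum>i\<in>I. f i x)"
  unfolding smooth_on_def using Ck_on_sum[of S I _ f] by blast

lemma smooth_on_scaleR:
  "open S \<Longrightarrow> smooth_on S f \<Longrightarrow> smooth_on S g \<Longrightarrow> smooth_on S (\<lambda>x. f x *\<^sub>R g x)"
  unfolding smooth_on_def using Ck_on_bounded_bilinear[OF bounded_bilinear_scaleR, of S _ f g] by blast

lemma smooth_on_compose:
  fixes f :: "'a::euclidean_space \<Rightarrow> 'b::euclidean_space"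
  assumes "open S" "open U" "f ` S \<subseteq> U" "smooth_on S f" "smooth_on U g"
  shows "smooth_on S (\<lambda>x. g (f x))"
  using assms(4,5) Ck_on_compose[OF assms(1-3)] unfolding smooth_on_def by blast

lemma smooth_on_Pair:
  assumes "open S" "smooth_on S f" "smooth_on S g"
  shows "smooth_on S (\<lambda>x. (f x, g x))"
proof -
  have "smooth_on S (\<lambda>x. (f x, 0) + (0, g x))"
    using smooth_on_bounded_linear[OF bounded_linear_Pair[OF bounded_linear_ident bounded_linear_zero] assms(1,2)]
      smooth_on_bounded_linear[OF bounded_linear_Pair[OF bounded_linear_zero bounded_linear_ident] assms(1,3)]
    by (rule smooth_on_add[OF assms(1)])
  then show ?thesis by simp
qed

lemma smooth_on_has_derivative:
  "smooth_on S f \<Longrightarrow> x \<in> S \<Longrightarrow> (f has_derivative frechet_derivative f (at x)) (at x)"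
  unfolding smooth_on_def using Ck_on_has_derivative[of 0 S f x] by blast

lemma smooth_on_differentiable: "smooth_on S f \<Longrightarrow> x \<in> S \<Longrightarrow> f differentiable (at x)"
  unfolding differentiable_def using smooth_on_has_derivative[of S f x] by blast

lemma smooth_on_continuous_on: "smooth_on S f \<Longrightarrow> continuous_on S f"
  by (metis smooth_on_def Ck_on.simps(1))

lemma smooth_on_frechet_derivative:
  "smooth_on S f \<Longrightarrow> smooth_on S (\<lambda>x. frechet_derivative f (at x) v)"
  unfolding smooth_on_def
proof
  fix k
  assume "\<forall>k. Ck_on k S f"
  then have "Ck_on (Suc k) S f" ..
  then show "Ck_on k S (\<lambda>x. frechet_derivative f (at x) v)" by simp
qed

lemma linear_frechet_derivative_smooth:
  "smooth_on S f \<Longrightarrow> x \<in> S \<Longrightarrow> linear (frechet_derivative f (at x))"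
  by (rule has_derivative_linear[OF smooth_on_has_derivative])

text \<open>
  The derivative of \<open>f\<close> is smooth in the base point for each fixed direction. A direction that
  varies with the point is expanded in the standard basis, so that linearity of the derivative
  reduces this case to finitely many fixed directions with smooth coefficients.
\<close>

lemma smooth_on_frechet_derivative_apply:
  fixes g :: "'a::euclidean_space \<Rightarrow> 'b::euclidean_space"
    and f :: "'b \<Rightarrow> 'c::real_normed_vector"
  assumes "open S" "open U" "g ` S \<subseteq> U" "smooth_on S g" "smooth_on U f" "smooth_on S X"
  shows "smooth_on S (\<lambda>x. frechet_derivative f (at (g x)) (X x))"
proof (rule smooth_on_transform[OF _ assms(1)])
  show "smooth_on S (\<lambda>x. \<Sum>b\<in>Basis. (X x \<bullet> b) *\<^sub>R frechet_derivative f (at (g x)) b)"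
    by (intro smooth_on_sum smooth_on_scaleR assms(1)
        smooth_on_compose[OF assms(1-4) smooth_on_frechet_derivative[OF assms(5)]]
        smooth_on_bounded_linear[OF bounded_linear_inner_left assms(1,6)])
  show "frechet_derivative f (at (g x)) (X x) =
      (\<Sum>b\<in>Basis. (X x \<bullet> b) *\<^sub>R frechet_derivative f (at (g x)) b)" if "x \<in> S" for x
    by (rule linear_eq_sum_Basis[OF linear_frechet_derivative_smooth[OF assms(5)]]) (use assms(3) that in blast)
qed

lemma smooth_on_frechet_derivative_along:
  fixes X :: "'a::euclidean_space \<Rightarrow> 'a"
  assumes "open S" "smooth_on S f" "smooth_on S X"
  shows "smooth_on S (\<lambda>x. frechet_derivative f (at x) (X x))"
  by (rule smooth_on_frechet_derivative_apply[OF assms(1,1) _ smooth_on_ident assms(2,3)]) simp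

section \<open>Symmetry of second derivatives\<close>

text \<open>
  The second difference over the parallelogram spanned by \<open>h v\<close> and \<open>h w\<close> is symmetric in \<open>v\<close> and
  \<open>w\<close>. Two applications of the mean value theorem, first along \<open>v\<close> and then along \<open>w\<close>, express
  it by an iterated derivative at an intermediate point.
\<close>

lemma second_difference_mvt:
  fixes f :: "'a::euclidean_space \<Rightarrow> real"
  assumes f: "\<And>y. y \<in> ball x \<delta> \<Longrightarrow> f differentiable (at y)"
    and g: "\<And>y. y \<in> ball x \<delta> \<Longrightarrow> (\<lambda>y. frechet_derivative f (at y) v) differentiable (at y)"
    and h: "0 < h" "h * (norm v + norm w) < \<delta>"
  shows "\<exists>y \<in> ball x \<delta>. f (x + h *\<^sub>R v + h *\<^sub>R w) - f (x + h *\<^sub>R v) - f (x + h *\<^sub>R w) + f x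
           = h * h * frechet_derivative (\<lambda>y. frechet_derivative f (at y) v) (at y) w"
proof -
  let ?g = "\<lambda>y. frechet_derivative f (at y) v"
  have ball: "x + s *\<^sub>R v + u *\<^sub>R w \<in> ball x \<delta>" if "0 \<le> s" "s \<le> h" "0 \<le> u" "u \<le> h" for s u
  proof -
    have "norm (s *\<^sub>R v + u *\<^sub>R w) \<le> s * norm v + u * norm w"
      using that norm_triangle_ineq[of "s *\<^sub>R v" "u *\<^sub>R w"] by simp
    also have "\<dots> \<le> h * norm v + h * norm w"
      using that by (intro add_mono mult_right_mono) auto
    also have "\<dots> < \<delta>" using h(2) by (simp add: algebra_simps)
    finally show ?thesis
      by (simp add: dist_norm add.assoc norm_minus_commute add.commute)
  qed
  have dir: "((\<lambda>s. F (p + s *\<^sub>R d)) has_real_derivative frechet_derivative F (at (p + s *\<^sub>R d)) d) (at s)"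
    if "F differentiable (at (p + s *\<^sub>R d))" for F :: "'a \<Rightarrow> real" and p d s
  proof -
    let ?D = "frechet_derivative F (at (p + s *\<^sub>R d))"
    have 1: "(F has_derivative ?D) (at (p + s *\<^sub>R d))"
      using that frechet_derivative_works by blast
    have "((\<lambda>s. p + s *\<^sub>R d) has_derivative (\<lambda>r. r *\<^sub>R d)) (at s)"
      by (auto intro!: derivative_eq_intros)
    then have "((\<lambda>s. F (p + s *\<^sub>R d)) has_derivative (\<lambda>r. ?D (r *\<^sub>R d))) (at s)"
      using has_derivative_compose 1 by blast
    moreover have "?D (r *\<^sub>R d) = ?D d * r" for r
      using linear_scale[OF has_derivative_linear[OF 1]] by simp
    ultimately show ?thesis
      by (simp add: has_field_derivative_def)
  qed
  define \<phi> where "\<phi> s = f ((x + h *\<^sub>R w) + s *\<^sub>R v) - f (x + s *\<^sub>R v)" for s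
  have "\<exists>\<xi>. 0 < \<xi> \<and> \<xi> < h \<and> \<phi> h - \<phi> 0 = (h - 0) * (?g ((x + h *\<^sub>R w) + \<xi> *\<^sub>R v) - ?g (x + \<xi> *\<^sub>R v))"
    unfolding \<phi>_def
    by (rule MVT2[OF h(1)]; rule DERIV_diff; rule dir; rule f)
      (use ball[of _ h] ball[of _ 0] h(1) in \<open>auto simp: algebra_simps\<close>)
  then obtain \<xi> where \<xi>: "0 < \<xi>" "\<xi> < h"
    "\<phi> h - \<phi> 0 = h * (?g ((x + h *\<^sub>R w) + \<xi> *\<^sub>R v) - ?g (x + \<xi> *\<^sub>R v))" by auto
  have "\<exists>\<eta>. 0 < \<eta> \<and> \<eta> < h \<and> ?g ((x + \<xi> *\<^sub>R v) + h *\<^sub>R w) - ?g ((x + \<xi> *\<^sub>R v) + 0 *\<^sub>R w)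
          = (h - 0) * frechet_derivative ?g (at ((x + \<xi> *\<^sub>R v) + \<eta> *\<^sub>R w)) w"
    by (rule MVT2[OF h(1)]; rule dir; rule g) (use ball[of \<xi>] \<xi> in auto)
  then obtain \<eta> where \<eta>: "0 < \<eta>" "\<eta> < h"
    "?g ((x + \<xi> *\<^sub>R v) + h *\<^sub>R w) - ?g (x + \<xi> *\<^sub>R v) = h * frechet_derivative ?g (at ((x + \<xi> *\<^sub>R v) + \<eta> *\<^sub>R w)) w"
    by auto
  have "f (x + h *\<^sub>R v + h *\<^sub>R w) - f (x + h *\<^sub>R v) - f (x + h *\<^sub>R w) + f x = \<phi> h - \<phi> 0"
    by (simp add: \<phi>_def algebra_simps)
  also have "\<dots> = h * h * frechet_derivative ?g (at ((x + \<xi> *\<^sub>R v) + \<eta> *\<^sub>R w)) w"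
    using \<xi>(3) \<eta>(3) by (simp add: algebra_simps)
  finally show ?thesis
    using ball[of \<xi> \<eta>] \<xi> \<eta> by (intro bexI[of _ "(x + \<xi> *\<^sub>R v) + \<eta> *\<^sub>R w"]) auto
qed

text \<open>
  With \<open>v\<close> and \<open>w\<close> exchanged, the same second difference is also the other iterated derivative at
  another nearby point. Both iterated derivatives are continuous at \<open>x\<close>, so they cannot differ
  there.
\<close>

lemma second_derivative_symmetric_real:
  fixes f :: "'a::euclidean_space \<Rightarrow> real"
  assumes "open S" "smooth_on S f" "x \<in> S"
  shows "frechet_derivative (\<lambda>y. frechet_derivative f (at y) v) (at x) w =
         frechet_derivative (\<lambda>y. frechet_derivative f (at y) w) (at x) v" (is "?A x = ?B x")
proof (rule ccontr)
  assume neq: "?A x \<noteq> ?B x"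
  define \<epsilon> where "\<epsilon> = \<bar>?A x - ?B x\<bar> / 2"
  have "\<epsilon> > 0" using neq by (simp add: \<epsilon>_def)
  have "smooth_on S ?A" "smooth_on S ?B"
    by (intro smooth_on_frechet_derivative assms)+
  then have "isCont ?A x" "isCont ?B x"
    using assms smooth_on_continuous_on continuous_on_eq_continuous_at by blast+
  then obtain a b where ab: "a > 0" "\<And>y. dist y x < a \<Longrightarrow> dist (?A y) (?A x) < \<epsilon>"
    "b > 0" "\<And>y. dist y x < b \<Longrightarrow> dist (?B y) (?B x) < \<epsilon>"
    using \<open>\<epsilon> > 0\<close> unfolding continuous_at_eps_delta by metis
  obtain c where c: "c > 0" "ball x c \<subseteq> S"
    using assms open_contains_ball by blast
  define \<delta> where "\<delta> = min a (min b c)"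
  have \<delta>: "\<delta> > 0" "ball x \<delta> \<subseteq> S" "\<delta> \<le> a" "\<delta> \<le> b"
    using ab c by (auto simp: \<delta>_def)
  \<comment> \<open>The summand 1 makes the bound strict, and it keeps \<open>h\<close> positive if \<open>v = w = 0\<close>.\<close>
  define h where "h = \<delta> / (norm v + norm w + 1)"
  have h: "0 < h" "h * (norm v + norm w) < \<delta>" "h * (norm w + norm v) < \<delta>"
  proof -
    have p: "norm v + norm w + 1 > 0" by (simp add: add_nonneg_pos)
    then show "0 < h" using \<delta>(1) by (simp add: h_def)
    have "h * (norm v + norm w + 1) = \<delta>" using p by (simp add: h_def)
    then show "h * (norm v + norm w) < \<delta>" using \<open>0 < h\<close> by (simp add: algebra_simps)
    then show "h * (norm w + norm v) < \<delta>" by (simp add: algebra_simps)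
  qed
  have d: "f differentiable (at y)" "(\<lambda>y. frechet_derivative f (at y) u) differentiable (at y)"
    if "y \<in> ball x \<delta>" for y u
    using that \<delta>(2) smooth_on_differentiable[OF assms(2)]
      smooth_on_differentiable[OF smooth_on_frechet_derivative[OF assms(2)]] by auto
  obtain y where y: "y \<in> ball x \<delta>"
      "f (x + h *\<^sub>R v + h *\<^sub>R w) - f (x + h *\<^sub>R v) - f (x + h *\<^sub>R w) + f x = h * h * ?A y"
    using second_difference_mvt[OF d(1) d(2) h(1,2)] by blast
  obtain z where z: "z \<in> ball x \<delta>"
      "f (x + h *\<^sub>R w + h *\<^sub>R v) - f (x + h *\<^sub>R w) - f (x + h *\<^sub>R v) + f x = h * h * ?B z"
    using second_difference_mvt[OF d(1) d(2) h(1,3)] by blast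
  have "h * h * ?A y = h * h * ?B z"
    using y(2) z(2) by (simp add: algebra_simps)
  then have "?A y = ?B z" using h(1) by simp
  moreover have "dist (?A y) (?A x) < \<epsilon>" "dist (?B z) (?B x) < \<epsilon>"
    using y(1) z(1) \<delta> ab(2)[of y] ab(4)[of z] by (simp_all add: dist_commute)
  moreover have False if "p = q" "\<bar>p - a\<bar> < \<bar>a - b\<bar> / 2" "\<bar>q - b\<bar> < \<bar>a - b\<bar> / 2" for p q a b :: real
    using that by (auto simp: abs_if split: if_splits)
  ultimately show False
    unfolding \<epsilon>_def dist_real_def by blast
qed

lemma second_derivative_symmetric:
  fixes f :: "'a::euclidean_space \<Rightarrow> 'b::euclidean_space"
  assumes "open S" "smooth_on S f" "x \<in> S"
  shows "frechet_derivative (\<lambda>y. frechet_derivative f (at y) v) (at x) w =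
         frechet_derivative (\<lambda>y. frechet_derivative f (at y) w) (at x) v"
proof (rule euclidean_eqI)
  fix b :: 'b assume "b \<in> Basis"
  have comp: "frechet_derivative (\<lambda>y. F y \<bullet> b) (at y) u = frechet_derivative F (at y) u \<bullet> b"
    if "smooth_on S F" "y \<in> S" for F :: "'a \<Rightarrow> 'b" and y u
    using frechet_derivative_at[OF bounded_linear.has_derivative[OF bounded_linear_inner_left
          smooth_on_has_derivative[OF that]], of b] by metis
  let ?f = "\<lambda>y. f y \<bullet> b"
  have *: "frechet_derivative (\<lambda>y. frechet_derivative f (at y) v) (at x) w \<bullet> b =
        frechet_derivative (\<lambda>y. frechet_derivative ?f (at y) v) (at x) w" for v w
  proof -
    have "frechet_derivative (\<lambda>y. frechet_derivative ?f (at y) v) (at x) =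
          frechet_derivative (\<lambda>y. frechet_derivative f (at y) v \<bullet> b) (at x)"
      by (rule frechet_derivative_cong_open[OF assms(1,3)]) (rule comp[OF assms(2)])
    then show ?thesis
      using comp[OF smooth_on_frechet_derivative[OF assms(2)] assms(3)] by simp
  qed
  have "smooth_on S ?f"
    by (intro smooth_on_bounded_linear[OF bounded_linear_inner_left] assms)
  then show "frechet_derivative (\<lambda>y. frechet_derivative f (at y) v) (at x) w \<bullet> b =
        frechet_derivative (\<lambda>y. frechet_derivative f (at y) w) (at x) v \<bullet> b"
    unfolding * by (rule second_derivative_symmetric_real[OF assms(1) _ assms(3)])
qed

section \<open>Vector fields in a smooth atlas\<close>

abbreviation chart_inv :: "('p, 'v) chart \<Rightarrow> 'v \<Rightarrow> 'p" where
  "chart_inv c \<equiv> inv_into (fst c) (snd c)"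

text \<open>
  The product rule for the image of a field \<open>Y\<close> under the derivative of \<open>\<tau>\<close>. The first summand is
  the second derivative of \<open>\<tau>\<close>; it is symmetric in \<open>Y x\<close> and \<open>v\<close> and drops out of Lie brackets.
\<close>

lemma frechet_derivative_field_image:
  fixes \<tau> :: "'a::euclidean_space \<Rightarrow> 'b::euclidean_space"
  assumes "open S" "smooth_on S \<tau>" "x \<in> S" "Y differentiable (at x)"
  shows "frechet_derivative (\<lambda>y. frechet_derivative \<tau> (at y) (Y y)) (at x) v =
         frechet_derivative (\<lambda>y. frechet_derivative \<tau> (at y) (Y x)) (at x) v +
         frechet_derivative \<tau> (at x) (frechet_derivative Y (at x) v)"
proof -
  let ?D = "\<lambda>u. frechet_derivative (\<lambda>y. frechet_derivative \<tau> (at y) u) (at x)"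
  note lin = linear_frechet_derivative_smooth[OF assms(2)]
  have D: "((\<lambda>y. frechet_derivative \<tau> (at y) u) has_derivative ?D u) (at x)" for u
    by (rule smooth_on_has_derivative[OF smooth_on_frechet_derivative[OF assms(2)] assms(3)])
  have Y: "(Y has_derivative frechet_derivative Y (at x)) (at x)"
    using assms(4) frechet_derivative_works by blast
  have "((\<lambda>y. \<Sum>b\<in>Basis. (Y y \<bullet> b) *\<^sub>R frechet_derivative \<tau> (at y) b) has_derivative
     (\<lambda>v. \<Sum>b\<in>Basis. (Y x \<bullet> b) *\<^sub>R ?D b v + (frechet_derivative Y (at x) v \<bullet> b) *\<^sub>R frechet_derivative \<tau> (at x) b)) (at x)"
    by (intro has_derivative_sum has_derivative_scaleR D has_derivative_inner_left Y)
  then have "((\<lambda>y. frechet_derivative \<tau> (at y) (Y y)) has_derivative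
     (\<lambda>v. \<Sum>b\<in>Basis. (Y x \<bullet> b) *\<^sub>R ?D b v + (frechet_derivative Y (at x) v \<bullet> b) *\<^sub>R frechet_derivative \<tau> (at x) b)) (at x)"
    by (rule has_derivative_transform_within_open[OF _ assms(1,3)])
      (rule linear_eq_sum_Basis[OF lin, symmetric])
  then have 1: "frechet_derivative (\<lambda>y. frechet_derivative \<tau> (at y) (Y y)) (at x) v =
     (\<Sum>b\<in>Basis. (Y x \<bullet> b) *\<^sub>R ?D b v) +
     (\<Sum>b\<in>Basis. (frechet_derivative Y (at x) v \<bullet> b) *\<^sub>R frechet_derivative \<tau> (at x) b)"
    by (simp add: frechet_derivative_at[symmetric] sum.distrib)
  have "((\<lambda>y. \<Sum>b\<in>Basis. (Y x \<bullet> b) *\<^sub>R frechet_derivative \<tau> (at y) b) has_derivative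
     (\<lambda>v. \<Sum>b\<in>Basis. (Y x \<bullet> b) *\<^sub>R ?D b v)) (at x)"
    by (intro has_derivative_sum has_derivative_scaleR_right D)
  then have "((\<lambda>y. frechet_derivative \<tau> (at y) (Y x)) has_derivative
     (\<lambda>v. \<Sum>b\<in>Basis. (Y x \<bullet> b) *\<^sub>R ?D b v)) (at x)"
    by (rule has_derivative_transform_within_open[OF _ assms(1,3)])
      (rule linear_eq_sum_Basis[OF lin, symmetric])
  then have 2: "?D (Y x) v = (\<Sum>b\<in>Basis. (Y x \<bullet> b) *\<^sub>R ?D b v)"
    by (simp add: frechet_derivative_at[symmetric])
  show ?thesis
    unfolding 1 2 linear_eq_sum_Basis[OF lin[OF assms(3)], of "frechet_derivative Y (at x) v"] ..
qed

lemma frechet_derivative_compose':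
  assumes "(f has_derivative f') (at x)" "g differentiable (at (f x))"
  shows "frechet_derivative (\<lambda>y. g (f y)) (at x) v = frechet_derivative g (at (f x)) (f' v)"
  using has_derivative_compose[OF assms(1) assms(2)[unfolded frechet_derivative_works]]
  by (simp add: frechet_derivative_at[symmetric])

locale atlas =
  fixes A :: "('p, 'v::euclidean_space) chart set"
  assumes smooth_atlas: "smooth_atlas A"
begin

abbreviation opn :: "'p set \<Rightarrow> bool" where
  "opn \<equiv> openin (atlas_topology A)"

lemma chart_inj: "c \<in> A \<Longrightarrow> inj_on (snd c) (fst c)"
  using smooth_atlas unfolding smooth_atlas_def by blast

lemma chart_inv_chart [simp]: "c \<in> A \<Longrightarrow> p \<in> fst c \<Longrightarrow> chart_inv c (snd c p) = p"
  by (rule inv_into_f_f[OF chart_inj])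

lemma transition_chart [simp]: "c \<in> A \<Longrightarrow> p \<in> fst c \<Longrightarrow> transition c c' (snd c p) = snd c' p"
  by (simp add: transition_def)

lemma open_overlap: "c \<in> A \<Longrightarrow> c' \<in> A \<Longrightarrow> open (snd c ` (fst c \<inter> fst c'))"
  and smooth_transition: "c \<in> A \<Longrightarrow> c' \<in> A \<Longrightarrow> smooth_on (snd c ` (fst c \<inter> fst c')) (transition c c')"
  using smooth_atlas unfolding smooth_atlas_def by blast+

lemma open_chart_image: "opn W \<Longrightarrow> c \<in> A \<Longrightarrow> open (snd c ` (W \<inter> fst c))"
  unfolding openin_atlas_topology[OF smooth_atlas] by blast

lemma open_chart_image_overlap:
  assumes "opn W" "c \<in> A" "c' \<in> A"
  shows "open (snd c ` (W \<inter> fst c \<inter> fst c'))"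
proof -
  have "snd c ` (W \<inter> fst c \<inter> fst c') = snd c ` (W \<inter> fst c) \<inter> snd c ` (fst c \<inter> fst c')"
    using chart_inj[OF assms(2)] unfolding inj_on_def by blast
  then show ?thesis
    using open_chart_image[OF assms(1,2)] open_overlap[OF assms(2,3)] by (simp add: open_Int)
qed

lemma openin_chart_domain: "c \<in> A \<Longrightarrow> opn (fst c)"
  unfolding openin_atlas_topology[OF smooth_atlas] atlas_carrier_def
  using open_overlap by (auto simp: Int_commute)

lemma jacobian_has_derivative:
  assumes "c \<in> A" "c' \<in> A" "p \<in> fst c" "p \<in> fst c'"
  shows "(transition c c' has_derivative jacobian c c' p) (at (snd c p))"
  unfolding jacobian_def
  by (rule smooth_on_has_derivative[OF smooth_transition[OF assms(1,2)]]) (use assms in blast)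

lemma linear_jacobian:
  "c \<in> A \<Longrightarrow> c' \<in> A \<Longrightarrow> p \<in> fst c \<Longrightarrow> p \<in> fst c' \<Longrightarrow> linear (jacobian c c' p)"
  by (rule has_derivative_linear[OF jacobian_has_derivative])

lemma jacobian_same [simp]:
  assumes "c \<in> A" "p \<in> fst c"
  shows "jacobian c c p v = v"
proof -
  have "frechet_derivative (transition c c) (at (snd c p)) = frechet_derivative (\<lambda>x. x) (at (snd c p))"
    by (rule frechet_derivative_cong_open[OF open_overlap[OF assms(1) assms(1)]]) (use assms in auto)
  then show ?thesis by (simp add: jacobian_def)
qed

text \<open>
  The chain rule for changes of coordinates; it makes a field that is prescribed in one chart
  consistent in all others.
\<close>

lemma jacobian_compose:
  assumes "c \<in> A" "c' \<in> A" "c'' \<in> A" "p \<in> fst c" "p \<in> fst c'" "p \<in> fst c''"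
  shows "jacobian c' c'' p (jacobian c c' p v) = jacobian c c'' p v"
proof -
  let ?O = "snd c ` (fst c \<inter> fst c' \<inter> fst c'')"
  have "open ?O"
    using open_chart_image_overlap[OF openin_chart_domain[OF assms(2)] assms(1,3)]
    by (simp add: Int_commute)
  moreover have "transition c' c'' (transition c c' y) = transition c c'' y" if "y \<in> ?O" for y
    using that assms by auto
  moreover have "snd c p \<in> ?O"
    using assms by blast
  ultimately have "frechet_derivative (\<lambda>y. transition c' c'' (transition c c' y)) (at (snd c p)) = jacobian c c'' p"
    unfolding jacobian_def by (intro frechet_derivative_cong_open) auto
  moreover have "transition c' c'' differentiable (at (transition c c' (snd c p)))"
    using jacobian_has_derivative[OF assms(2,3,5,6)] assms unfolding differentiable_def by auto
  ultimately show ?thesis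
    using frechet_derivative_compose'[OF jacobian_has_derivative[OF assms(1,2,4,5)], of "transition c' c''" v] assms
    by (simp add: jacobian_def)
qed

lemma chart_expression_change:
  assumes "c \<in> A" "c' \<in> A" "y \<in> snd c' ` (W \<inter> fst c \<inter> fst c')"
  shows "(f \<circ> chart_inv c') y = (f \<circ> chart_inv c) (transition c' c y)"
  using assms by auto

text \<open>
  Where charts overlap, smoothness may be tested in either of them, because the transition maps are smooth.
\<close>

lemma smooth_change_chart:
  fixes f :: "'p \<Rightarrow> 'b::real_normed_vector"
  assumes "opn W" "c \<in> A" "c' \<in> A" "smooth_on (snd c ` (W \<inter> fst c \<inter> fst c')) (f \<circ> chart_inv c)"
  shows "smooth_on (snd c' ` (W \<inter> fst c \<inter> fst c')) (f \<circ> chart_inv c')"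
proof -
  let ?O = "snd c' ` (W \<inter> fst c \<inter> fst c')"
  have op: "open ?O" "open (snd c ` (W \<inter> fst c \<inter> fst c'))"
    using open_chart_image_overlap[OF assms(1,3,2)] open_chart_image_overlap[OF assms(1,2,3)]
    by (simp_all add: Int_assoc Int_commute[of "fst c"])
  have "transition c' c ` ?O \<subseteq> snd c ` (W \<inter> fst c \<inter> fst c')"
    using assms by auto
  moreover have "smooth_on ?O (transition c' c)"
    by (rule smooth_on_subset[OF smooth_transition[OF assms(3,2)]]) auto
  ultimately have "smooth_on ?O (\<lambda>y. (f \<circ> chart_inv c) (transition c' c y))"
    by (rule smooth_on_compose[OF op _ _ assms(4)])
  then show ?thesis
    by (rule smooth_on_transform[OF _ op(1) chart_expression_change[OF assms(2,3)]])
qed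

lemma smooth_functionI_chart:
  fixes f :: "'p \<Rightarrow> 'b::real_normed_vector"
  assumes "opn W" "c \<in> A" "W \<subseteq> fst c" "smooth_on (snd c ` W) (f \<circ> chart_inv c)"
  shows "smooth_function A W f"
  unfolding smooth_function_def
proof
  fix c' assume c': "c' \<in> A"
  have eq: "W \<inter> fst c \<inter> fst c' = W \<inter> fst c'" using assms(3) by blast
  have "smooth_on (snd c ` (W \<inter> fst c \<inter> fst c')) (f \<circ> chart_inv c)"
    by (rule smooth_on_subset[OF assms(4)]) auto
  from smooth_change_chart[OF assms(1,2) c' this] show "smooth_on (snd c' ` (W \<inter> fst c')) (f \<circ> chart_inv c')"
    by (simp only: eq)
qed

lemma vector_fieldsD:
  assumes "X \<in> vector_fields A W"
  shows "\<not> (c \<in> A \<and> p \<in> W \<inter> fst c) \<Longrightarrow> X p c = 0"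
    and "c \<in> A \<Longrightarrow> c' \<in> A \<Longrightarrow> p \<in> W \<Longrightarrow> p \<in> fst c \<Longrightarrow> p \<in> fst c' \<Longrightarrow> X p c' = jacobian c c' p (X p c)"
    and "c \<in> A \<Longrightarrow> smooth_on (snd c ` (W \<inter> fst c)) ((\<lambda>p. X p c) \<circ> chart_inv c)"
  using assms unfolding vector_fields_def by blast+

lemma vector_fieldsI:
  assumes "\<And>p c. \<not> (c \<in> A \<and> p \<in> W \<inter> fst c) \<Longrightarrow> X p c = 0"
    and "\<And>c c' p. c \<in> A \<Longrightarrow> c' \<in> A \<Longrightarrow> p \<in> W \<Longrightarrow> p \<in> fst c \<Longrightarrow> p \<in> fst c' \<Longrightarrow> X p c' = jacobian c c' p (X p c)"
    and "\<And>c. c \<in> A \<Longrightarrow> smooth_on (snd c ` (W \<inter> fst c)) ((\<lambda>p. X p c) \<circ> chart_inv c)"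
  shows "X \<in> vector_fields A W"
  using assms unfolding vector_fields_def by blast

text \<open>
  On the domain of a chart a field is determined by its components in that chart. This turns
  computations in a single chart into equations between fields, which is the form in which they
  can be inserted into a connection.
\<close>

lemma vector_field_eqI:
  assumes "X \<in> vector_fields A W" "Y \<in> vector_fields A W" "c \<in> A" "W \<subseteq> fst c"
    and "\<And>p. p \<in> W \<Longrightarrow> X p c = Y p c"
  shows "X = Y"
proof (intro ext)
  fix p c'
  show "X p c' = Y p c'"
  proof (cases "c' \<in> A \<and> p \<in> W \<inter> fst c'")
    case True
    then show ?thesis
      using vector_fieldsD(2)[OF assms(1,3), of c' p] vector_fieldsD(2)[OF assms(2,3), of c' p] assms(4,5)
      by auto
  next
    case False
    then show ?thesis using vector_fieldsD(1)[OF assms(1)] vector_fieldsD(1)[OF assms(2)] by metis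
  qed
qed

lemma field_from_chart_in_vector_fields:
  assumes "opn W" "c \<in> A" "W \<subseteq> fst c" "smooth_on (snd c ` W) (f \<circ> chart_inv c)"
  shows "field_from_chart A W c f \<in> vector_fields A W"
proof (rule vector_fieldsI)
  fix p c' assume "\<not> (c' \<in> A \<and> p \<in> W \<inter> fst c')"
  then show "field_from_chart A W c f p c' = 0"
    by (auto simp: field_from_chart_def)
next
  fix c' c'' p assume *: "c' \<in> A" "c'' \<in> A" "p \<in> W" "p \<in> fst c'" "p \<in> fst c''"
  then show "field_from_chart A W c f p c'' = jacobian c' c'' p (field_from_chart A W c f p c')"
    using assms(2,3) by (simp add: field_from_chart_def subset_eq jacobian_compose)
next
  fix c' assume c': "c' \<in> A"
  let ?O = "snd c ` (W \<inter> fst c \<inter> fst c')"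
  have eq: "W \<inter> fst c \<inter> fst c' = W \<inter> fst c'" using assms(3) by blast
  have op: "open ?O" by (rule open_chart_image_overlap[OF assms(1,2) c'])
  have "smooth_on ?O (\<lambda>x. frechet_derivative (transition c c') (at x) ((f \<circ> chart_inv c) x))"
    by (rule smooth_on_frechet_derivative_along[OF op]; rule smooth_on_subset,
        rule smooth_transition[OF assms(2) c'] assms(4)) auto
  moreover have "((\<lambda>p. field_from_chart A W c f p c') \<circ> chart_inv c) x =
      frechet_derivative (transition c c') (at x) ((f \<circ> chart_inv c) x)" if "x \<in> ?O" for x
    using that assms(2) c' by (auto simp: field_from_chart_def jacobian_def)
  ultimately have "smooth_on ?O ((\<lambda>p. field_from_chart A W c f p c') \<circ> chart_inv c)"
    by (rule smooth_on_transform[OF _ op])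
  from smooth_change_chart[OF assms(1,2) c' this]
  show "smooth_on (snd c' ` (W \<inter> fst c')) ((\<lambda>p. field_from_chart A W c f p c') \<circ> chart_inv c')"
    unfolding eq .
qed

lemma vector_fields_zero: "(\<lambda>p c. 0) \<in> vector_fields A W"
proof (rule vector_fieldsI)
  fix c c' p assume "c \<in> A" "c' \<in> A" "p \<in> W" "p \<in> fst c" "p \<in> fst c'"
  then show "0 = jacobian c c' p 0"
    using linear_0[OF linear_jacobian[of c c' p]] by simp
qed (auto simp: o_def smooth_on_const)

lemma vector_fields_add:
  assumes "opn W" "X \<in> vector_fields A W" "Y \<in> vector_fields A W"
  shows "(\<lambda>p c. X p c + Y p c) \<in> vector_fields A W"
proof (rule vector_fieldsI)
  fix p c assume "\<not> (c \<in> A \<and> p \<in> W \<inter> fst c)"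
  then show "X p c + Y p c = 0"
    using vector_fieldsD(1)[OF assms(2)] vector_fieldsD(1)[OF assms(3)] by simp
next
  fix c c' p assume *: "c \<in> A" "c' \<in> A" "p \<in> W" "p \<in> fst c" "p \<in> fst c'"
  show "X p c' + Y p c' = jacobian c c' p (X p c + Y p c)"
    unfolding linear_add[OF linear_jacobian[OF *(1,2,4,5)]]
    using vector_fieldsD(2)[OF assms(2) *] vector_fieldsD(2)[OF assms(3) *] by simp
next
  fix c assume c: "c \<in> A"
  show "smooth_on (snd c ` (W \<inter> fst c)) ((\<lambda>p. X p c + Y p c) \<circ> chart_inv c)"
    using smooth_on_add[OF open_chart_image[OF assms(1) c] vector_fieldsD(3)[OF assms(2) c] vector_fieldsD(3)[OF assms(3) c]]
    by (simp add: o_def)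
qed

lemma vector_fields_scale:
  assumes "opn W" "smooth_function A W f" "X \<in> vector_fields A W"
  shows "(\<lambda>p c. f p *\<^sub>R X p c) \<in> vector_fields A W"
proof (rule vector_fieldsI)
  fix p c assume "\<not> (c \<in> A \<and> p \<in> W \<inter> fst c)"
  then show "f p *\<^sub>R X p c = 0"
    using vector_fieldsD(1)[OF assms(3)] by simp
next
  fix c c' p assume *: "c \<in> A" "c' \<in> A" "p \<in> W" "p \<in> fst c" "p \<in> fst c'"
  show "f p *\<^sub>R X p c' = jacobian c c' p (f p *\<^sub>R X p c)"
    unfolding linear_scale[OF linear_jacobian[OF *(1,2,4,5)]]
    using vector_fieldsD(2)[OF assms(3) *] by simp
next
  fix c assume c: "c \<in> A"
  then have "smooth_on (snd c ` (W \<inter> fst c)) (f \<circ> chart_inv c)"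
    using assms(2) unfolding smooth_function_def by blast
  then show "smooth_on (snd c ` (W \<inter> fst c)) ((\<lambda>p. f p *\<^sub>R X p c) \<circ> chart_inv c)"
    using smooth_on_scaleR[OF open_chart_image[OF assms(1) c] _ vector_fieldsD(3)[OF assms(3) c]]
    by (simp add: o_def)
qed

lemma vector_fields_sum:
  assumes "opn W" "\<And>i. i \<in> I \<Longrightarrow> smooth_function A W (f i)" "\<And>i. i \<in> I \<Longrightarrow> X i \<in> vector_fields A W"
  shows "(\<lambda>p c. \<Sum>i\<in>I. f i p *\<^sub>R X i p c) \<in> vector_fields A W"
  using assms(2,3)
proof (induction I rule: infinite_finite_induct)
  case (insert i I)
  then show ?case
    using vector_fields_add[OF assms(1) vector_fields_scale[OF assms(1), of "f i" "X i"]] by simp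
qed (simp_all add: vector_fields_zero)

lemma field_action_cong:
  assumes "opn W" "c \<in> A" "p \<in> W" "p \<in> fst c" "\<And>q. q \<in> W \<Longrightarrow> q \<in> fst c \<Longrightarrow> f q = g q"
  shows "field_action c X f p = field_action c X g p"
proof -
  have "frechet_derivative (f \<circ> chart_inv c) (at (snd c p)) = frechet_derivative (g \<circ> chart_inv c) (at (snd c p))"
    by (rule frechet_derivative_cong_open[OF open_chart_image[OF assms(1,2)]]) (use assms in auto)
  then show ?thesis by (simp add: field_action_def)
qed

lemma field_action_change_chart:
  assumes "c \<in> A" "c' \<in> A" "X \<in> vector_fields A W" "p \<in> W" "p \<in> fst c" "p \<in> fst c'"
    and "(f \<circ> chart_inv c) differentiable (at (snd c p))"
  shows "field_action c' X f p = field_action c X f p"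
proof -
  note J = jacobian_has_derivative[OF assms(2,1,6,5)]
  have "frechet_derivative (f \<circ> chart_inv c') (at (snd c' p)) =
        frechet_derivative (\<lambda>y. (f \<circ> chart_inv c) (transition c' c y)) (at (snd c' p))"
    by (rule frechet_derivative_cong_open[OF open_overlap[OF assms(2,1)]]) (use assms in auto)
  then have "field_action c' X f p =
      frechet_derivative (f \<circ> chart_inv c) (at (snd c p)) (jacobian c' c p (X p c'))"
    using frechet_derivative_compose'[OF J, of "f \<circ> chart_inv c"] assms by (simp add: field_action_def)
  then show ?thesis
    using vector_fieldsD(2)[OF assms(3,2,1,4,6,5)] by (simp add: field_action_def)
qed

lemma vector_field_differentiable:
  assumes "X \<in> vector_fields A W" "c \<in> A" "p \<in> W" "p \<in> fst c"
  shows "((\<lambda>q. X q c) \<circ> chart_inv c) differentiable (at (snd c p))"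
  by (rule smooth_on_differentiable[OF vector_fieldsD(3)[OF assms(1,2)]]) (use assms in blast)

text \<open>
  The derivative of the components of \<open>Y\<close> along \<open>X\<close> is not tensorial: the transition map contributes
  its second derivative.
\<close>

lemma field_action_component:
  assumes W: "opn W" and XY: "X \<in> vector_fields A W" "Y \<in> vector_fields A W"
    and c: "c \<in> A" "c' \<in> A" and p: "p \<in> W" "p \<in> fst c" "p \<in> fst c'"
  shows "field_action c' X (\<lambda>q. Y q c') p =
    frechet_derivative (\<lambda>y. frechet_derivative (transition c c') (at y) (Y p c)) (at (snd c p)) (X p c) +
    jacobian c c' p (field_action c X (\<lambda>q. Y q c) p)"
proof -
  let ?O = "snd c ` (W \<inter> fst c \<inter> fst c')"
  let ?g = "\<lambda>y. frechet_derivative (transition c c') (at y) (((\<lambda>q. Y q c) \<circ> chart_inv c) y)"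
  have op: "open ?O" by (rule open_chart_image_overlap[OF W c])
  have x: "snd c p \<in> ?O" using p by blast
  have sm: "smooth_on ?O (transition c c')"
    by (rule smooth_on_subset[OF smooth_transition[OF c]]) auto
  have "smooth_on ?O ?g"
    by (rule smooth_on_frechet_derivative_along[OF op sm smooth_on_subset[OF vector_fieldsD(3)[OF XY(2) c(1)]]]) auto
  have eq: "((\<lambda>q. Y q c') \<circ> chart_inv c) y = ?g y" if y: "y \<in> ?O" for y
  proof -
    obtain q where "y = snd c q" "q \<in> W" "q \<in> fst c" "q \<in> fst c'" using y by blast
    then show ?thesis
      using vector_fieldsD(2)[OF XY(2) c, of q] c by (simp add: jacobian_def)
  qed
  have "((\<lambda>q. Y q c') \<circ> chart_inv c) differentiable (at (snd c p))"
    by (rule smooth_on_differentiable[OF smooth_on_transform[OF \<open>smooth_on ?O ?g\<close> op] x]) (rule eq)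
  then have "field_action c' X (\<lambda>q. Y q c') p = field_action c X (\<lambda>q. Y q c') p"
    by (rule field_action_change_chart[OF c XY(1) p])
  also have "\<dots> = frechet_derivative ?g (at (snd c p)) (X p c)"
    unfolding field_action_def
    by (rule fun_cong[where x = "X p c"], rule frechet_derivative_cong_open[OF op x]) (rule eq)
  also have "\<dots> = frechet_derivative (\<lambda>y. frechet_derivative (transition c c') (at y) (Y p c)) (at (snd c p)) (X p c)
      + frechet_derivative (transition c c') (at (snd c p)) (field_action c X (\<lambda>q. Y q c) p)"
    using frechet_derivative_field_image[OF op sm x vector_field_differentiable[OF XY(2) c(1) p(1,2)]] c p
    by (simp add: field_action_def)
  finally show ?thesis by (simp add: jacobian_def)
qed

text \<open>
  The second derivatives of the transition map in the two terms of the bracket cancel by symmetry,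
  and what is left transforms with the Jacobian.
\<close>

lemma lie_bracket_in_vector_fields:
  assumes W: "opn W" and XY: "X \<in> vector_fields A W" "Y \<in> vector_fields A W"
  shows "lie_bracket A W X Y \<in> vector_fields A W"
proof (rule vector_fieldsI)
  fix p c assume "\<not> (c \<in> A \<and> p \<in> W \<inter> fst c)"
  then show "lie_bracket A W X Y p c = 0" by (auto simp: lie_bracket_def)
next
  fix c c' p assume *: "c \<in> A" "c' \<in> A" "p \<in> W" "p \<in> fst c" "p \<in> fst c'"
  let ?H = "\<lambda>u v. frechet_derivative (\<lambda>y. frechet_derivative (transition c c') (at y) u) (at (snd c p)) v"
  have "?H (Y p c) (X p c) = ?H (X p c) (Y p c)"
    by (rule second_derivative_symmetric[OF open_overlap[OF *(1,2)] smooth_transition[OF *(1,2)]]) (use * in blast)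
  then show "lie_bracket A W X Y p c' = jacobian c c' p (lie_bracket A W X Y p c)"
    using * field_action_component[OF W XY *] field_action_component[OF W XY(2,1) *]
      linear_diff[OF linear_jacobian[OF *(1,2,4,5)]]
    by (simp add: lie_bracket_def)
next
  fix c assume c: "c \<in> A"
  let ?O = "snd c ` (W \<inter> fst c)"
  let ?X = "(\<lambda>q. X q c) \<circ> chart_inv c" and ?Y = "(\<lambda>q. Y q c) \<circ> chart_inv c"
  have op: "open ?O" by (rule open_chart_image[OF W c])
  have "smooth_on ?O (\<lambda>x. frechet_derivative ?Y (at x) (?X x) - frechet_derivative ?X (at x) (?Y x))"
    by (intro smooth_on_diff smooth_on_frechet_derivative_along op vector_fieldsD(3)[OF XY(1) c] vector_fieldsD(3)[OF XY(2) c])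
  moreover have "((\<lambda>p. lie_bracket A W X Y p c) \<circ> chart_inv c) x =
      frechet_derivative ?Y (at x) (?X x) - frechet_derivative ?X (at x) (?Y x)" if "x \<in> ?O" for x
    using that c by (auto simp: lie_bracket_def field_action_def)
  ultimately show "smooth_on ?O ((\<lambda>p. lie_bracket A W X Y p c) \<circ> chart_inv c)"
    by (rule smooth_on_transform[OF _ op])
qed

end

section \<open>Linear connections on finite combinations of fields\<close>

locale atlas_connection = atlas A for A :: "('p, 'v::euclidean_space) chart set" +
  fixes nabla :: "('p, 'v) connection"
  assumes linear_connection: "linear_connection A nabla"
begin

lemmas connection_laws = linear_connection[unfolded linear_connection_def, THEN spec, THEN mp]

lemma connection_field:
  assumes "opn W" "X \<in> vector_fields A W" "Y \<in> vector_fields A W"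
  shows "nabla W X Y \<in> vector_fields A W"
  by (rule connection_laws[OF assms(1), THEN conjunct1, THEN bspec, THEN bspec, OF assms(2,3)])

lemma connection_add_left:
  assumes "opn W" "X \<in> vector_fields A W" "Y \<in> vector_fields A W" "Z \<in> vector_fields A W"
  shows "nabla W (\<lambda>p c. X p c + Y p c) Z = (\<lambda>p c. nabla W X Z p c + nabla W Y Z p c)"
  by (rule connection_laws[OF assms(1), THEN conjunct2, THEN conjunct1,
      THEN bspec, THEN bspec, THEN bspec, OF assms(2-4)])

lemma connection_add_right:
  assumes "opn W" "X \<in> vector_fields A W" "Y \<in> vector_fields A W" "Z \<in> vector_fields A W"
  shows "nabla W X (\<lambda>p c. Y p c + Z p c) = (\<lambda>p c. nabla W X Y p c + nabla W X Z p c)"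
  by (rule connection_laws[OF assms(1), THEN conjunct2, THEN conjunct2, THEN conjunct1,
      THEN bspec, THEN bspec, THEN bspec, OF assms(2-4)])

lemma connection_smooth_scale:
  assumes "opn W" "smooth_function A W f" "X \<in> vector_fields A W" "Y \<in> vector_fields A W"
  shows "nabla W (\<lambda>p c. f p *\<^sub>R X p c) Y = (\<lambda>p c. f p *\<^sub>R nabla W X Y p c) \<and>
    (\<forall>c\<in>A. \<forall>p \<in> W \<inter> fst c. nabla W X (\<lambda>p c. f p *\<^sub>R Y p c) p c =
       field_action c X f p *\<^sub>R Y p c + f p *\<^sub>R nabla W X Y p c)"
  by (rule connection_laws[OF assms(1), THEN conjunct2, THEN conjunct2, THEN conjunct2, THEN conjunct1,
      THEN spec, THEN mp, THEN bspec, THEN bspec, OF assms(2-4)])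

lemma connection_scale_left:
  assumes "opn W" "smooth_function A W f" "X \<in> vector_fields A W" "Y \<in> vector_fields A W"
  shows "nabla W (\<lambda>p c. f p *\<^sub>R X p c) Y = (\<lambda>p c. f p *\<^sub>R nabla W X Y p c)"
  by (rule connection_smooth_scale[OF assms, THEN conjunct1])

lemma connection_Leibniz:
  assumes "opn W" "smooth_function A W f" "X \<in> vector_fields A W" "Y \<in> vector_fields A W" "c \<in> A" "p \<in> W" "p \<in> fst c"
  shows "nabla W X (\<lambda>p c. f p *\<^sub>R Y p c) p c = field_action c X f p *\<^sub>R Y p c + f p *\<^sub>R nabla W X Y p c"
  using connection_smooth_scale[OF assms(1-4), THEN conjunct2, THEN bspec, THEN bspec, of c p] assms(5-7) by simp

lemma connection_zero:
  assumes "opn W" "X \<in> vector_fields A W"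
  shows "nabla W (\<lambda>p c. 0) X p c = 0" and "nabla W X (\<lambda>p c. 0) p c = 0"
  using fun_cong[OF fun_cong[OF connection_add_left[OF assms(1) vector_fields_zero vector_fields_zero assms(2)]], of p c]
    fun_cong[OF fun_cong[OF connection_add_right[OF assms vector_fields_zero vector_fields_zero]], of p c]
  by simp_all

lemma connection_sum_left:
  assumes "opn W" "Y \<in> vector_fields A W"
    and "\<And>i. i \<in> I \<Longrightarrow> smooth_function A W (f i)" "\<And>i. i \<in> I \<Longrightarrow> X i \<in> vector_fields A W"
  shows "nabla W (\<lambda>p c. \<Sum>i\<in>I. f i p *\<^sub>R X i p c) Y p c = (\<Sum>i\<in>I. f i p *\<^sub>R nabla W (X i) Y p c)"
  using assms(3,4)
proof (induction I rule: infinite_finite_induct)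
  case (insert i I)
  then show ?case
    using connection_add_left[OF assms(1) vector_fields_scale[OF assms(1), of "f i" "X i"]
        vector_fields_sum[OF assms(1), of I f X] assms(2)]
      connection_scale_left[OF assms(1), of "f i" "X i" Y] assms(2)
    by simp
qed (simp_all add: connection_zero assms)

lemma connection_sum_right:
  assumes "opn W" "X \<in> vector_fields A W" "c \<in> A" "p \<in> W" "p \<in> fst c"
    and "\<And>i. i \<in> I \<Longrightarrow> smooth_function A W (f i)" "\<And>i. i \<in> I \<Longrightarrow> Y i \<in> vector_fields A W"
  shows "nabla W X (\<lambda>p c. \<Sum>i\<in>I. f i p *\<^sub>R Y i p c) p c =
    (\<Sum>i\<in>I. field_action c X (f i) p *\<^sub>R Y i p c + f i p *\<^sub>R nabla W X (Y i) p c)"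
  using assms(6,7)
proof (induction I rule: infinite_finite_induct)
  case (insert i I)
  then show ?case
    using connection_add_right[OF assms(1,2) vector_fields_scale[OF assms(1), of "f i" "Y i"]
        vector_fields_sum[OF assms(1), of I f Y]]
      connection_Leibniz[OF assms(1) _ assms(2) _ assms(3-5), of "f i" "Y i"]
    by simp
qed (simp_all add: connection_zero assms)

end

section \<open>The smooth atlas of the jet space\<close>

text \<open>
  Compatibility with the standard coordinate says that a time chart is a diffeomorphism between
  open subsets of the line.
\<close>

lemma time_chart:
  assumes "c \<in> time_charts"
  shows "inj_on (snd c) (fst c)" "open (fst c)" "open (snd c ` fst c)"
    "smooth_on (fst c) (snd c)" "smooth_on (snd c ` fst c) (chart_inv c)"
proof -
  have sa: "smooth_atlas {(UNIV, id), c}" using assms by (simp add: time_charts_def)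
  have overlap: "open (snd (UNIV, id) ` (fst (UNIV, id) \<inter> fst c))"
    and trans: "smooth_on (snd (UNIV, id) ` (fst (UNIV, id) \<inter> fst c)) (transition (UNIV, id) c)"
    and trans': "smooth_on (snd c ` (fst c \<inter> fst (UNIV, id))) (transition c (UNIV, id))"
    using sa[unfolded smooth_atlas_def, THEN conjunct2, THEN bspec, THEN bspec, of "(UNIV, id)" c]
      sa[unfolded smooth_atlas_def, THEN conjunct2, THEN bspec, THEN bspec, of c "(UNIV, id)"]
    by simp_all
  show "inj_on (snd c) (fst c)" "open (snd c ` fst c)"
    using sa unfolding smooth_atlas_def by blast+
  show "open (fst c)" using overlap by simp
  have "transition (UNIV, id) c = snd c" by (simp add: transition_def)
  then show "smooth_on (fst c) (snd c)" using trans by simp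
  have "transition c (UNIV, id) = chart_inv c" by (simp add: transition_def)
  then show "smooth_on (snd c ` fst c) (chart_inv c)" using trans' by simp
qed

lemma time_chart_inv [simp]: "c \<in> time_charts \<Longrightarrow> t \<in> fst c \<Longrightarrow> chart_inv c (snd c t) = t"
  by (rule inv_into_f_f[OF time_chart(1)])

lemma open_time_overlap:
  assumes "c \<in> time_charts" "c' \<in> time_charts"
  shows "open (snd c ` (fst c \<inter> fst c'))"
proof -
  have "snd c ` (fst c \<inter> fst c') = snd c ` fst c \<inter> chart_inv c -` fst c'"
    using assms(1) by (auto intro!: imageI)
  then show ?thesis
    using continuous_open_preimage[OF smooth_on_continuous_on[OF time_chart(5)] time_chart(3) time_chart(2)] assms
    by simp
qed

lemma smooth_time_transition:
  assumes "c \<in> time_charts" "c' \<in> time_charts"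
  shows "smooth_on (snd c ` (fst c \<inter> fst c')) (transition c c')"
proof -
  have "smooth_on (snd c ` (fst c \<inter> fst c')) (\<lambda>s. snd c' (chart_inv c s))"
    by (rule smooth_on_compose[OF open_time_overlap[OF assms] time_chart(2)[OF assms(2)] _
          smooth_on_subset[OF time_chart(5)[OF assms(1)]] time_chart(4)[OF assms(2)]])
      (use assms in auto)
  then show ?thesis by (simp add: transition_def o_def)
qed

definition speed :: "(real, real) chart \<Rightarrow> real \<Rightarrow> real" where
  "speed c t = frechet_derivative (snd c) (at t) 1"

definition inv_speed :: "(real, real) chart \<Rightarrow> real \<Rightarrow> real" where
  "inv_speed c s = frechet_derivative (chart_inv c) (at s) 1"

lemma inv_speed_speed:
  assumes "c \<in> time_charts" "t \<in> fst c"
  shows "inv_speed c (snd c t) * speed c t = 1"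
proof -
  have s: "snd c t \<in> snd c ` fst c" using assms by blast
  note Dc = smooth_on_has_derivative[OF time_chart(4)[OF assms(1)] assms(2)]
  note Di = smooth_on_has_derivative[OF time_chart(5)[OF assms(1)] s]
  have "((\<lambda>u. chart_inv c (snd c u)) has_derivative
      (\<lambda>h. frechet_derivative (chart_inv c) (at (snd c t)) (frechet_derivative (snd c) (at t) h))) (at t)"
    by (rule has_derivative_compose[OF Dc Di])
  moreover have "((\<lambda>u. chart_inv c (snd c u)) has_derivative (\<lambda>h. h)) (at t)"
    by (rule has_derivative_transform_within_open[OF has_derivative_ident time_chart(2)[OF assms(1)] assms(2)])
      (use assms in simp)
  ultimately have "frechet_derivative (chart_inv c) (at (snd c t)) (speed c t) = 1"
    using has_derivative_unique unfolding speed_def by metis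
  moreover have "frechet_derivative (chart_inv c) (at (snd c t)) (speed c t *\<^sub>R 1) =
      speed c t *\<^sub>R frechet_derivative (chart_inv c) (at (snd c t)) 1"
    by (rule linear_scale[OF has_derivative_linear[OF Di]])
  ultimately show ?thesis by (simp add: inv_speed_def mult.commute)
qed

context atlas begin

text \<open>
  Smoothness of a curve near \<open>t\<close> is witnessed in some chart; shrinking the time interval, any other
  chart around \<open>\<gamma> t\<close> serves as well.
\<close>

lemma smooth_curve_in_chart:
  fixes \<gamma> :: "real \<Rightarrow> 'p"
  assumes c: "c0 \<in> A" "c \<in> A" and I: "open I" "t \<in> I" "\<gamma> ` I \<subseteq> fst c0" "smooth_on I (snd c0 \<circ> \<gamma>)"
    and t: "\<gamma> t \<in> fst c"
  obtains J where "open J" "t \<in> J" "\<gamma> ` J \<subseteq> fst c0 \<inter> fst c" "smooth_on J (snd c \<circ> \<gamma>)"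
proof
  let ?J = "I \<inter> (snd c0 \<circ> \<gamma>) -` (snd c0 ` (fst c0 \<inter> fst c))"
  show op: "open ?J"
    by (rule continuous_open_preimage[OF smooth_on_continuous_on[OF I(4)] I(1) open_overlap[OF c]])
  show "t \<in> ?J" using I t by auto
  show J: "\<gamma> ` ?J \<subseteq> fst c0 \<inter> fst c"
  proof (rule subsetI)
    fix p assume "p \<in> \<gamma> ` ?J"
    then obtain u q where u: "u \<in> I" "p = \<gamma> u" and q: "snd c0 (\<gamma> u) = snd c0 q" "q \<in> fst c0" "q \<in> fst c" by auto
    then have "p \<in> fst c0" using I(3) by auto
    then have "p = q" using inj_onD[OF chart_inj[OF c(1)] q(1) _ q(2)] u(2) by simp
    then show "p \<in> fst c0 \<inter> fst c" using q by simp
  qed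
  have "smooth_on ?J (\<lambda>u. transition c0 c ((snd c0 \<circ> \<gamma>) u))"
    by (rule smooth_on_compose[OF op open_overlap[OF c] _ smooth_on_subset[OF I(4)] smooth_transition[OF c]]) auto
  then show "smooth_on ?J (snd c \<circ> \<gamma>)"
  proof (rule smooth_on_transform[OF _ op])
    fix u assume "u \<in> ?J"
    then have "\<gamma> u \<in> fst c0" using J by blast
    then show "(snd c \<circ> \<gamma>) u = transition c0 c ((snd c0 \<circ> \<gamma>) u)"
      using c by simp
  qed
qed

end

locale jet_base = atlas A for A :: "('m, real^'n::finite) chart set"
begin

lemma curve_in_chart:
  assumes "smooth_curve_at A t \<gamma>" "d \<in> A" "\<gamma> t \<in> fst d"
  obtains J where "open J" "t \<in> J" "\<gamma> ` J \<subseteq> fst d" "smooth_on J (snd d \<circ> \<gamma>)"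
proof -
  obtain c I where I: "c \<in> A" "open I" "t \<in> I" "\<gamma> ` I \<subseteq> fst c" "smooth_on I (snd c \<circ> \<gamma>)"
    using assms(1) unfolding smooth_curve_at_def by (elim bexE exE conjE)
  obtain J where J: "open J" "t \<in> J" "\<gamma> ` J \<subseteq> fst c \<inter> fst d" "smooth_on J (snd d \<circ> \<gamma>)"
    by (rule smooth_curve_in_chart[OF I(1) assms(2) I(2-5) assms(3)])
  show ?thesis
    by (rule that[OF J(1,2) _ J(4)]) (use J(3) in blast)
qed

definition velocity :: "('m, real^'n) chart \<Rightarrow> real \<Rightarrow> (real \<Rightarrow> 'm) \<Rightarrow> real^'n" where
  "velocity d t \<gamma> = vector_derivative (snd d \<circ> \<gamma>) (at t)"

lemma curve_has_velocity:
  assumes "smooth_curve_at A t \<gamma>" "d \<in> A" "\<gamma> t \<in> fst d"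
  shows "((snd d \<circ> \<gamma>) has_vector_derivative velocity d t \<gamma>) (at t)"
proof -
  obtain J where J: "t \<in> J" "smooth_on J (snd d \<circ> \<gamma>)"
    by (rule curve_in_chart[OF assms])
  show ?thesis
    unfolding velocity_def
    by (rule vector_derivative_works[THEN iffD1, OF smooth_on_differentiable[OF J(2,1)]])
qed

text \<open>
  The chain rule along the curve: velocities are tangent vectors.
\<close>

lemma velocity_change_chart:
  assumes "smooth_curve_at A t \<gamma>" "d \<in> A" "d' \<in> A" "\<gamma> t \<in> fst d" "\<gamma> t \<in> fst d'"
  shows "velocity d' t \<gamma> = jacobian d d' (\<gamma> t) (velocity d t \<gamma>)"
proof -
  obtain J where J: "open J" "t \<in> J" "\<gamma> ` J \<subseteq> fst d"
    by (rule curve_in_chart[OF assms(1,2,4)])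
  note T = jacobian_has_derivative[OF assms(2-5)]
  have "((\<lambda>u. transition d d' ((snd d \<circ> \<gamma>) u)) has_derivative
      (\<lambda>h. jacobian d d' (\<gamma> t) (h *\<^sub>R velocity d t \<gamma>))) (at t)"
    by (rule has_derivative_compose[OF curve_has_velocity[OF assms(1,2,4), unfolded has_vector_derivative_def]])
      (use T in simp)
  then have "((snd d' \<circ> \<gamma>) has_derivative (\<lambda>h. jacobian d d' (\<gamma> t) (h *\<^sub>R velocity d t \<gamma>))) (at t)"
    by (rule has_derivative_transform_within_open[OF _ J(1,2)]) (use J(3) assms(2) in auto)
  then have "((snd d' \<circ> \<gamma>) has_vector_derivative jacobian d d' (\<gamma> t) (velocity d t \<gamma>)) (at t)"
    unfolding has_vector_derivative_def linear_scale[OF linear_jacobian[OF assms(2-5)]] .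
  then show ?thesis
    unfolding velocity_def by (rule vector_derivative_at)
qed

text \<open>
  The fibre coordinate of a jet is taken with respect to the time chart; this separates the
  dependence on the time chart from the dependence on the chart of \<open>M\<close>.
\<close>

lemma reparametrized_velocity:
  assumes "smooth_curve_at A t \<gamma>" "d \<in> A" "\<gamma> t \<in> fst d" "c \<in> time_charts" "t \<in> fst c"
  shows "vector_derivative (snd d \<circ> \<gamma> \<circ> chart_inv c) (at (snd c t)) = inv_speed c (snd c t) *\<^sub>R velocity d t \<gamma>"
proof -
  have s: "snd c t \<in> snd c ` fst c" using assms by blast
  have D: "(chart_inv c has_derivative frechet_derivative (chart_inv c) (at (snd c t))) (at (snd c t))"
    by (rule smooth_on_has_derivative[OF time_chart(5)[OF assms(4)] s])
  have "frechet_derivative (chart_inv c) (at (snd c t)) = (\<lambda>h. h *\<^sub>R inv_speed c (snd c t))"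
  proof
    show "frechet_derivative (chart_inv c) (at (snd c t)) h = h *\<^sub>R inv_speed c (snd c t)" for h
      using linear_scale[OF has_derivative_linear[OF D], of h 1] by (simp only: inv_speed_def real_scaleR_def mult_1_right)
  qed
  then have "(chart_inv c has_vector_derivative inv_speed c (snd c t)) (at (snd c t))"
    unfolding has_vector_derivative_def using D by (simp only:)
  moreover have "((snd d \<circ> \<gamma>) has_vector_derivative velocity d t \<gamma>) (at (chart_inv c (snd c t)))"
    using curve_has_velocity[OF assms(1-3)] assms(4,5) by simp
  ultimately show ?thesis
    by (intro vector_derivative_at vector_diff_chain_at)
qed

lemma equiv_jet_rel: "equiv {(t, \<gamma>). smooth_curve_at A t \<gamma>} (jet_rel A)"
proof (rule equivI)
  show "jet_rel A \<subseteq> {(t, \<gamma>). smooth_curve_at A t \<gamma>} \<times> {(t, \<gamma>). smooth_curve_at A t \<gamma>}"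
    by (clarsimp simp: jet_rel_def)
  show "refl_on {(t, \<gamma>). smooth_curve_at A t \<gamma>} (jet_rel A)"
    by (rule refl_onI) (clarsimp simp: jet_rel_def)
  show "sym (jet_rel A)"
    by (rule symI) (clarsimp simp: jet_rel_def)
  show "trans (jet_rel A)"
    by (rule transI) (clarsimp simp: jet_rel_def)
qed

lemma jet_rel_base: "((t, \<gamma>), (s, \<sigma>)) \<in> jet_rel A \<Longrightarrow> s = t \<and> \<sigma> t = \<gamma> t"
  by (clarsimp simp: jet_rel_def)

text \<open>
  Velocities in one chart determine those in all others, so equality of 1-jets may be tested in a
  single chart. This gives injectivity of the jet charts.
\<close>

lemma jet_rel_iff:
  assumes "smooth_curve_at A t \<gamma>" "smooth_curve_at A t \<sigma>" "d \<in> A" "\<gamma> t \<in> fst d"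
  shows "((t, \<gamma>), (t, \<sigma>)) \<in> jet_rel A \<longleftrightarrow> \<sigma> t = \<gamma> t \<and> velocity d t \<sigma> = velocity d t \<gamma>"
proof
  assume rel: "((t, \<gamma>), (t, \<sigma>)) \<in> jet_rel A"
  then have "\<forall>c\<in>A. \<gamma> t \<in> fst c \<longrightarrow> velocity c t \<gamma> = velocity c t \<sigma>"
    by (simp add: jet_rel_def velocity_def)
  then show "\<sigma> t = \<gamma> t \<and> velocity d t \<sigma> = velocity d t \<gamma>"
    using jet_rel_base[OF rel] assms(3,4) by simp
next
  assume *: "\<sigma> t = \<gamma> t \<and> velocity d t \<sigma> = velocity d t \<gamma>"
  have "velocity c t \<gamma> = velocity c t \<sigma>" if "c \<in> A" "\<gamma> t \<in> fst c" for c
  proof -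
    have "\<sigma> t \<in> fst d" "\<sigma> t \<in> fst c" using * assms(4) that(2) by simp_all
    from velocity_change_chart[OF assms(2,3) that(1) this]
      velocity_change_chart[OF assms(1,3) that(1) assms(4) that(2)]
    show ?thesis using * by simp
  qed
  then show "((t, \<gamma>), (t, \<sigma>)) \<in> jet_rel A"
    using assms(1,2) * by (simp add: jet_rel_def velocity_def)
qed

lemma jet_space_nonempty: "e \<in> jet_space A \<Longrightarrow> \<exists>t \<gamma>. (t, \<gamma>) \<in> e"
  using in_quotient_imp_non_empty[OF equiv_jet_rel, of e] unfolding jet_space_def by (metis ex_in_conv surj_pair)

lemma jet_members_related:
  "e \<in> jet_space A \<Longrightarrow> r \<in> e \<Longrightarrow> r' \<in> e \<Longrightarrow> (r, r') \<in> jet_rel A"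
  using quotient_eq_iff[OF equiv_jet_rel, of e e r r'] unfolding jet_space_def by simp

lemma jet_member_smooth: "e \<in> jet_space A \<Longrightarrow> (t, \<gamma>) \<in> e \<Longrightarrow> smooth_curve_at A t \<gamma>"
  using jet_members_related[of e "(t, \<gamma>)" "(t, \<gamma>)"] by (simp add: jet_rel_def)

lemma jet_chart_domain_iff:
  assumes "e \<in> jet_space A" "(t, \<gamma>) \<in> e"
  shows "e \<in> fst (jet_chart A c d) \<longleftrightarrow> t \<in> fst c \<and> \<gamma> t \<in> fst d"
proof -
  have base: "s = t \<and> \<sigma> t = \<gamma> t" if "(s, \<sigma>) \<in> e" for s \<sigma>
    by (rule jet_rel_base[OF jet_members_related[OF assms that]])
  have "(\<forall>(s, \<sigma>)\<in>e. s \<in> fst c \<and> \<sigma> s \<in> fst d) \<longleftrightarrow> t \<in> fst c \<and> \<gamma> t \<in> fst d"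
  proof
    assume "\<forall>(s, \<sigma>)\<in>e. s \<in> fst c \<and> \<sigma> s \<in> fst d"
    from bspec[OF this assms(2)] show "t \<in> fst c \<and> \<gamma> t \<in> fst d" by simp
  next
    assume *: "t \<in> fst c \<and> \<gamma> t \<in> fst d"
    have "s \<in> fst c \<and> \<sigma> s \<in> fst d" if "(s, \<sigma>) \<in> e" for s \<sigma>
      using base[OF that] * by simp
    then show "\<forall>(s, \<sigma>)\<in>e. s \<in> fst c \<and> \<sigma> s \<in> fst d" by blast
  qed
  then show ?thesis using assms(1) by (simp add: jet_chart_def)
qed

lemma jet_chart_coordinates:
  assumes "c \<in> time_charts" "d \<in> A" "e \<in> jet_space A" "(t, \<gamma>) \<in> e" "t \<in> fst c" "\<gamma> t \<in> fst d"
  shows "snd (jet_chart A c d) e = (snd c t, snd d (\<gamma> t), inv_speed c (snd c t) *\<^sub>R velocity d t \<gamma>)"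
proof -
  obtain s \<sigma> where r: "(SOME r. r \<in> e) = (s, \<sigma>)" by fastforce
  have "(s, \<sigma>) \<in> e" using someI[of "\<lambda>r. r \<in> e" "(t, \<gamma>)"] assms(4) r by simp
  then have rel: "((t, \<gamma>), (s, \<sigma>)) \<in> jet_rel A" and sm: "smooth_curve_at A s \<sigma>"
    by (rule jet_members_related[OF assms(3,4)], rule jet_member_smooth[OF assms(3)])
  have st: "s = t" and base: "\<sigma> t = \<gamma> t" using jet_rel_base[OF rel] by simp_all
  have smt: "smooth_curve_at A t \<sigma>" using sm st by simp
  have "velocity d t \<sigma> = velocity d t \<gamma>"
    using rel unfolding st jet_rel_iff[OF jet_member_smooth[OF assms(3,4)] smt assms(2,6)] by simp
  moreover have "\<sigma> t \<in> fst d" using base assms(6) by simp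
  ultimately show ?thesis
    using r st base reparametrized_velocity[OF smt assms(2) _ assms(1,5)] by (simp add: jet_chart_def)
qed

lemma jet_chart_member:
  assumes "e \<in> fst (jet_chart A c d)"
  obtains t \<gamma> where "e \<in> jet_space A" "(t, \<gamma>) \<in> e" "smooth_curve_at A t \<gamma>" "t \<in> fst c" "\<gamma> t \<in> fst d"
proof -
  have e: "e \<in> jet_space A" using assms by (simp add: jet_chart_def)
  obtain t \<gamma> where m: "(t, \<gamma>) \<in> e" using jet_space_nonempty[OF e] by blast
  then show ?thesis
    using that[OF e m jet_member_smooth[OF e m]] jet_chart_domain_iff[OF e m] assms by simp
qed

lemma jet_chart_inj:
  assumes "c \<in> time_charts" "d \<in> A"
  shows "inj_on (snd (jet_chart A c d)) (fst (jet_chart A c d))"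
proof (rule inj_onI)
  fix e e' assume e: "e \<in> fst (jet_chart A c d)" and e': "e' \<in> fst (jet_chart A c d)"
    and eq: "snd (jet_chart A c d) e = snd (jet_chart A c d) e'"
  obtain t \<gamma> where 1: "e \<in> jet_space A" "(t, \<gamma>) \<in> e" "smooth_curve_at A t \<gamma>" "t \<in> fst c" "\<gamma> t \<in> fst d"
    using jet_chart_member[OF e] .
  obtain s \<sigma> where 2: "e' \<in> jet_space A" "(s, \<sigma>) \<in> e'" "smooth_curve_at A s \<sigma>" "s \<in> fst c" "\<sigma> s \<in> fst d"
    using jet_chart_member[OF e'] .
  have eqs: "snd c t = snd c s" "snd d (\<gamma> t) = snd d (\<sigma> s)"
    "inv_speed c (snd c t) *\<^sub>R velocity d t \<gamma> = inv_speed c (snd c s) *\<^sub>R velocity d s \<sigma>"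
    using eq jet_chart_coordinates[OF assms 1(1,2,4,5)] jet_chart_coordinates[OF assms 2(1,2,4,5)] by auto
  have ts: "s = t" by (rule inj_onD[OF time_chart(1)[OF assms(1)] eqs(1)[symmetric] 2(4) 1(4)])
  have "\<sigma> t = \<gamma> t"
    using inj_onD[OF chart_inj[OF assms(2)] eqs(2) 1(5) 2(5)] ts by simp
  moreover have "inv_speed c (snd c t) \<noteq> 0"
    using inv_speed_speed[OF assms(1) 1(4)] by auto
  then have "velocity d t \<sigma> = velocity d t \<gamma>"
    using eqs(3) ts by simp
  moreover have "smooth_curve_at A t \<sigma>" using 2(3) ts by simp
  ultimately have "((t, \<gamma>), (s, \<sigma>)) \<in> jet_rel A"
    unfolding ts using jet_rel_iff[OF 1(3) _ assms(2) 1(5)] by simp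
  then show "e = e'"
    using quotient_eq_iff[OF equiv_jet_rel 1(1)[unfolded jet_space_def] 2(1)[unfolded jet_space_def] 1(2) 2(2)] by simp
qed

text \<open>
  Every triple of coordinates is realized by a curve that is affine in the chart \<open>d\<close>. Hence the
  images of jet charts are products, and in particular open.
\<close>

lemma jet_chart_surj:
  assumes "c \<in> time_charts" "d \<in> A" "t \<in> fst c" "q \<in> fst d"
  obtains e \<gamma> where "e \<in> jet_space A" "(t, \<gamma>) \<in> e" "\<gamma> t = q" "snd (jet_chart A c d) e = (snd c t, snd d q, y)"
proof -
  \<comment> \<open>The prescribed \<open>y\<close> is a derivative with respect to the coordinate of \<open>c\<close>; \<open>v\<close> is the velocity with respect to \<open>t\<close>.\<close>
  define v where "v = speed c t *\<^sub>R y"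
  define line where "line u = snd d q + (u - t) *\<^sub>R v" for u :: real
  define \<gamma> where "\<gamma> u = chart_inv d (line u)" for u
  define I where "I = line -` (snd d ` fst d)"
  have ld: "(line has_vector_derivative v) (at t)"
    unfolding line_def by (auto intro!: derivative_eq_intros)
  have sml: "smooth_on UNIV line"
  proof -
    have "smooth_on UNIV (\<lambda>u. (snd d q - t *\<^sub>R v) + u *\<^sub>R v)"
      by (intro smooth_on_add smooth_on_const smooth_on_scaleR smooth_on_ident open_UNIV)
    then show ?thesis by (simp add: line_def[abs_def] algebra_simps)
  qed
  have opd: "open (snd d ` fst d)" using open_overlap[OF assms(2,2)] by simp
  have I: "open I" "t \<in> I"
    using continuous_open_preimage[OF smooth_on_continuous_on[OF sml] open_UNIV opd] assms(4)
    by (simp_all add: I_def line_def)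
  have dg: "snd d (\<gamma> u) = line u" and gd: "\<gamma> u \<in> fst d" if "u \<in> I" for u
    using that assms(2) by (auto simp: I_def \<gamma>_def)
  have "smooth_on I (snd d \<circ> \<gamma>)"
    by (rule smooth_on_transform[OF smooth_on_subset[OF sml] I(1)]) (simp_all add: dg)
  then have sm: "smooth_curve_at A t \<gamma>"
    unfolding smooth_curve_at_def
    by (intro bexI[OF _ assms(2)] exI[of _ I] conjI I) (use gd in blast)
  have "((snd d \<circ> \<gamma>) has_vector_derivative v) (at t)"
    by (rule has_vector_derivative_transform_within_open[OF ld I]) (simp add: dg)
  then have vel: "velocity d t \<gamma> = v"
    unfolding velocity_def by (rule vector_derivative_at)
  have gt: "\<gamma> t = q" using assms by (simp add: \<gamma>_def line_def)
  define e where "e = jet_rel A `` {(t, \<gamma>)}"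
  have e: "e \<in> jet_space A" "(t, \<gamma>) \<in> e"
    using sm equiv_class_self[OF equiv_jet_rel, of "(t, \<gamma>)"]
    by (auto simp: e_def jet_space_def intro!: quotientI)
  have "snd (jet_chart A c d) e = (snd c t, snd d q, inv_speed c (snd c t) *\<^sub>R speed c t *\<^sub>R y)"
    using jet_chart_coordinates[OF assms(1,2) e assms(3)] gt assms(4) vel by (simp add: v_def)
  then have "snd (jet_chart A c d) e = (snd c t, snd d q, y)"
    using inv_speed_speed[OF assms(1,3)] by simp
  with e gt show ?thesis using that by blast
qed

lemma jet_chart_image:
  assumes "c \<in> time_charts" "d \<in> A"
  shows "snd (jet_chart A c d) ` (fst (jet_chart A c d) \<inter> fst (jet_chart A c' d')) =
    snd c ` (fst c \<inter> fst c') \<times> snd d ` (fst d \<inter> fst d') \<times> UNIV" (is "?L = ?R")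
proof (rule equalityI; rule subsetI)
  fix z assume "z \<in> ?L"
  then obtain e where e: "e \<in> fst (jet_chart A c d)" "e \<in> fst (jet_chart A c' d')" "z = snd (jet_chart A c d) e" by blast
  obtain t \<gamma> where 1: "e \<in> jet_space A" "(t, \<gamma>) \<in> e" "t \<in> fst c" "\<gamma> t \<in> fst d"
    using jet_chart_member[OF e(1)] .
  then show "z \<in> ?R"
    using e(2,3) jet_chart_domain_iff[OF 1(1,2), of c' d'] jet_chart_coordinates[OF assms 1] by auto
next
  fix z assume "z \<in> ?R"
  then obtain t q y where z: "z = (snd c t, snd d q, y)" and t: "t \<in> fst c" "t \<in> fst c'" and q: "q \<in> fst d" "q \<in> fst d'"
    by auto
  obtain e \<gamma> where e: "e \<in> jet_space A" "(t, \<gamma>) \<in> e" "\<gamma> t = q" "snd (jet_chart A c d) e = (snd c t, snd d q, y)"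
    using jet_chart_surj[OF assms t(1) q(1)] .
  have "e \<in> fst (jet_chart A c d) \<inter> fst (jet_chart A c' d')"
    using jet_chart_domain_iff[OF e(1,2)] e(3) t q by auto
  then show "z \<in> ?L" using e(4) z by (metis imageI)
qed

text \<open>
  The transformation law of the jet coordinates: the new time depends on the time only, the new
  position on the position only, and the fibre coordinate transforms linearly by the Jacobian and
  the rescaling of time.
\<close>

lemma jet_transition:
  assumes c: "c \<in> time_charts" "c' \<in> time_charts" and d: "d \<in> A" "d' \<in> A"
    and z: "(s, x, y) \<in> snd (jet_chart A c d) ` (fst (jet_chart A c d) \<inter> fst (jet_chart A c' d'))"
  shows "transition (jet_chart A c d) (jet_chart A c' d') (s, x, y) =
    (transition c c' s, transition d d' x,
     (inv_speed c' (transition c c' s) * speed c (chart_inv c s)) *\<^sub>R frechet_derivative (transition d d') (at x) y)"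
proof -
  obtain e where e: "e \<in> fst (jet_chart A c d)" "e \<in> fst (jet_chart A c' d')" "(s, x, y) = snd (jet_chart A c d) e"
    using z by blast
  obtain t \<gamma> where 1: "e \<in> jet_space A" "(t, \<gamma>) \<in> e" "smooth_curve_at A t \<gamma>" "t \<in> fst c" "\<gamma> t \<in> fst d"
    using jet_chart_member[OF e(1)] .
  then have 2: "t \<in> fst c'" "\<gamma> t \<in> fst d'"
    using e(2) jet_chart_domain_iff[OF 1(1,2), of c' d'] by auto
  have sxy: "s = snd c t" "x = snd d (\<gamma> t)" "y = inv_speed c s *\<^sub>R velocity d t \<gamma>"
    using e(3) jet_chart_coordinates[OF c(1) d(1) 1(1,2,4,5)] by auto
  have tr: "transition c c' s = snd c' t" "chart_inv c s = t" "transition d d' x = snd d' (\<gamma> t)"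
    using sxy(1,2) 1(4,5) c d by (simp_all add: transition_def)
  have "transition (jet_chart A c d) (jet_chart A c' d') (s, x, y) = snd (jet_chart A c' d') e"
    using e(3) inv_into_f_f[OF jet_chart_inj[OF c(1) d(1)] e(1)] by (simp add: transition_def)
  also have "\<dots> = (snd c' t, snd d' (\<gamma> t), inv_speed c' (snd c' t) *\<^sub>R velocity d' t \<gamma>)"
    by (rule jet_chart_coordinates[OF c(2) d(2) 1(1,2) 2])
  also have "velocity d' t \<gamma> = frechet_derivative (transition d d') (at x) (velocity d t \<gamma>)"
    using velocity_change_chart[OF 1(3) d 1(5) 2(2)] sxy(2) by (simp add: jacobian_def)
  also have "velocity d t \<gamma> = speed c t *\<^sub>R y"
    using inv_speed_speed[OF c(1) 1(4)] sxy(1,3) by (simp add: mult.commute)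
  also have "frechet_derivative (transition d d') (at x) (speed c t *\<^sub>R y) =
      speed c t *\<^sub>R frechet_derivative (transition d d') (at x) y"
    using linear_scale[OF linear_jacobian[OF d 1(5) 2(2)]] sxy(2) by (simp add: jacobian_def)
  finally show ?thesis
    using tr by simp
qed

lemma open_jet_chart_image:
  assumes c: "c \<in> time_charts" "c' \<in> time_charts" and d: "d \<in> A" "d' \<in> A"
  shows "open (snd (jet_chart A c d) ` (fst (jet_chart A c d) \<inter> fst (jet_chart A c' d')))"
  unfolding jet_chart_image[OF c(1) d(1)]
  by (intro open_Times open_time_overlap[OF c] open_overlap[OF d] open_UNIV)

lemma smooth_jet_transition:
  assumes c: "c \<in> time_charts" "c' \<in> time_charts" and d: "d \<in> A" "d' \<in> A"
  shows "smooth_on (snd (jet_chart A c d) ` (fst (jet_chart A c d) \<inter> fst (jet_chart A c' d')))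
           (transition (jet_chart A c d) (jet_chart A c' d'))"
proof -
  let ?O = "snd (jet_chart A c d) ` (fst (jet_chart A c d) \<inter> fst (jet_chart A c' d'))"
  note op = open_jet_chart_image[OF assms]
  have sub: "fst ` ?O \<subseteq> snd c ` (fst c \<inter> fst c')" "(\<lambda>z. fst (snd z)) ` ?O \<subseteq> snd d ` (fst d \<inter> fst d')"
    unfolding jet_chart_image[OF c(1) d(1)] by auto
  have s1: "smooth_on ?O fst"
    by (rule smooth_on_bounded_linear[OF bounded_linear_fst op smooth_on_ident])
  have s2: "smooth_on ?O (\<lambda>z. fst (snd z))" "smooth_on ?O (\<lambda>z. snd (snd z))"
    by (rule smooth_on_bounded_linear[OF bounded_linear_fst_comp[OF bounded_linear_snd] op smooth_on_ident]
        smooth_on_bounded_linear[OF bounded_linear_snd_comp[OF bounded_linear_snd] op smooth_on_ident])+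
  have t: "smooth_on ?O (\<lambda>z. transition c c' (fst z))"
    by (rule smooth_on_compose[OF op open_time_overlap[OF c] sub(1) s1 smooth_time_transition[OF c]])
  have x: "smooth_on ?O (\<lambda>z. transition d d' (fst (snd z)))"
    by (rule smooth_on_compose[OF op open_overlap[OF d] sub(2) s2(1) smooth_transition[OF d]])
  have img: "chart_inv c (fst z) \<in> fst c" "transition c c' (fst z) \<in> snd c' ` fst c'" if "z \<in> ?O" for z
  proof -
    have "fst z \<in> snd c ` (fst c \<inter> fst c')"
      by (rule subsetD[OF sub(1) imageI[OF that]])
    then obtain t where "fst z = snd c t" "t \<in> fst c" "t \<in> fst c'" by auto
    then show "chart_inv c (fst z) \<in> fst c" "transition c c' (fst z) \<in> snd c' ` fst c'"
      using c by (simp_all add: transition_def)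
  qed
  have "smooth_on ?O (\<lambda>z. chart_inv c (fst z))"
    by (rule smooth_on_compose[OF op time_chart(3)[OF c(1)] _ s1 time_chart(5)[OF c(1)]])
      (use subset_trans[OF sub(1) image_mono[OF Int_lower1]] in simp)
  then have sp: "smooth_on ?O (\<lambda>z. speed c (chart_inv c (fst z)))"
    unfolding speed_def
    by (rule smooth_on_compose[OF op time_chart(2)[OF c(1)] _ _ smooth_on_frechet_derivative[OF time_chart(4)[OF c(1)]], rotated])
      (rule image_subsetI, rule img(1))
  have isp: "smooth_on ?O (\<lambda>z. inv_speed c' (transition c c' (fst z)))"
    unfolding inv_speed_def
    by (rule smooth_on_compose[OF op time_chart(3)[OF c(2)] _ t smooth_on_frechet_derivative[OF time_chart(5)[OF c(2)]]])
      (rule image_subsetI, rule img(2))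
  have D: "smooth_on ?O (\<lambda>z. frechet_derivative (transition d d') (at (fst (snd z))) (snd (snd z)))"
    by (rule smooth_on_frechet_derivative_apply[OF op open_overlap[OF d] sub(2) s2(1) smooth_transition[OF d] s2(2)])
  have "smooth_on ?O (\<lambda>z. (transition c c' (fst z), transition d d' (fst (snd z)),
     inv_speed c' (transition c c' (fst z)) *\<^sub>R speed c (chart_inv c (fst z)) *\<^sub>R
       frechet_derivative (transition d d') (at (fst (snd z))) (snd (snd z))))"
    by (intro smooth_on_Pair smooth_on_scaleR op t x sp isp D)
  then show ?thesis
  proof (rule smooth_on_transform[OF _ op])
    fix z assume "z \<in> ?O"
    then have "(fst z, fst (snd z), snd (snd z)) \<in> ?O" by simp
    from jet_transition[OF c d this]
    show "transition (jet_chart A c d) (jet_chart A c' d') z = (transition c c' (fst z), transition d d' (fst (snd z)),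
       inv_speed c' (transition c c' (fst z)) *\<^sub>R speed c (chart_inv c (fst z)) *\<^sub>R
         frechet_derivative (transition d d') (at (fst (snd z))) (snd (snd z)))"
      by simp
  qed
qed

lemma smooth_jet_atlas: "smooth_atlas (jet_atlas A)"
proof -
  have "open (snd (jet_chart A c d) ` fst (jet_chart A c d))" if "c \<in> time_charts" "d \<in> A" for c d
    using open_jet_chart_image[OF that(1,1) that(2,2)] by simp
  then show ?thesis
    unfolding smooth_atlas_def jet_atlas_def
    using jet_chart_inj open_jet_chart_image smooth_jet_transition by fastforce
qed

text \<open>
  Time and position of a jet in a new chart do not depend on the old fibre coordinate, so changes of
  coordinates preserve vertical vectors.
\<close>

lemma jacobian_vertical:
  assumes "\<Phi> \<in> jet_atlas A" "\<Psi> \<in> jet_atlas A" "e \<in> fst \<Phi>" "e \<in> fst \<Psi>"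
  shows "fst (jacobian \<Phi> \<Psi> e (0, 0, w)) = 0" "fst (snd (jacobian \<Phi> \<Psi> e (0, 0, w))) = 0"
proof -
  obtain c d c' d' where c: "c \<in> time_charts" "c' \<in> time_charts" and d: "d \<in> A" "d' \<in> A"
    and \<Phi>: "\<Phi> = jet_chart A c d" and \<Psi>: "\<Psi> = jet_chart A c' d'"
    using assms(1,2) unfolding jet_atlas_def by blast
  let ?O = "snd \<Phi> ` (fst \<Phi> \<inter> fst \<Psi>)"
  note op = open_jet_chart_image[OF c d, folded \<Phi> \<Psi>]
  have e: "snd \<Phi> e \<in> ?O" using assms by blast
  have J: "(transition \<Phi> \<Psi> has_derivative jacobian \<Phi> \<Psi> e) (at (snd \<Phi> e))"
    unfolding jacobian_def
    by (rule smooth_on_has_derivative[OF smooth_jet_transition[OF c d, folded \<Phi> \<Psi>] e])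
  have img: "?O = snd c ` (fst c \<inter> fst c') \<times> snd d ` (fst d \<inter> fst d') \<times> UNIV"
    using jet_chart_image[OF c(1) d(1), of c' d'] by (simp add: \<Phi> \<Psi>)
  have eq: "fst (transition \<Phi> \<Psi> z) = transition c c' (fst z)"
    "fst (snd (transition \<Phi> \<Psi> z)) = transition d d' (fst (snd z))" if "z \<in> ?O" for z
    using jet_transition[OF c d, of "fst z" "fst (snd z)" "snd (snd z)"] that by (simp_all add: \<Phi> \<Psi>)
  obtain f where f: "(transition c c' has_derivative f) (at (fst (snd \<Phi> e)))"
    using smooth_on_has_derivative[OF smooth_time_transition[OF c], of "fst (snd \<Phi> e)"] e unfolding img by auto
  obtain g where g: "(transition d d' has_derivative g) (at (fst (snd (snd \<Phi> e))))"
    using smooth_on_has_derivative[OF smooth_transition[OF d], of "fst (snd (snd \<Phi> e))"] e unfolding img by auto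
  have "((\<lambda>z. transition c c' (fst z)) has_derivative (\<lambda>h. fst (jacobian \<Phi> \<Psi> e h))) (at (snd \<Phi> e))"
    by (rule has_derivative_transform_within_open[OF has_derivative_fst[OF J] op e eq(1)])
  moreover have "((\<lambda>z. transition c c' (fst z)) has_derivative (\<lambda>h. f (fst h))) (at (snd \<Phi> e))"
    by (rule has_derivative_compose[OF has_derivative_fst[OF has_derivative_ident] f])
  ultimately have "(\<lambda>h. fst (jacobian \<Phi> \<Psi> e h)) = (\<lambda>h. f (fst h))"
    by (rule has_derivative_unique)
  then show "fst (jacobian \<Phi> \<Psi> e (0, 0, w)) = 0"
    using linear_0[OF has_derivative_linear[OF f]] by (metis fst_conv)
  have "((\<lambda>z. transition d d' (fst (snd z))) has_derivative (\<lambda>h. fst (snd (jacobian \<Phi> \<Psi> e h)))) (at (snd \<Phi> e))"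
    by (rule has_derivative_transform_within_open[OF has_derivative_fst[OF has_derivative_snd[OF J]] op e eq(2)])
  moreover have "((\<lambda>z. transition d d' (fst (snd z))) has_derivative (\<lambda>h. g (fst (snd h)))) (at (snd \<Phi> e))"
    by (rule has_derivative_compose[OF has_derivative_fst[OF has_derivative_snd[OF has_derivative_ident]] g])
  ultimately have "(\<lambda>h. fst (snd (jacobian \<Phi> \<Psi> e h))) = (\<lambda>h. g (fst (snd h)))"
    by (rule has_derivative_unique)
  then show "fst (snd (jacobian \<Phi> \<Psi> e (0, 0, w))) = 0"
    using linear_0[OF has_derivative_linear[OF g]] by (metis fst_conv snd_conv)
qed

end

section \<open>The adapted basis and its brackets\<close>

context atlas begin

lemma field_action_bounded_linear:
  assumes "bounded_linear h" "(f \<circ> chart_inv c) differentiable (at (snd c p))"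
  shows "field_action c X (\<lambda>q. h (f q)) p = h (field_action c X f p)"
proof -
  have "((\<lambda>x. h ((f \<circ> chart_inv c) x)) has_derivative
      (\<lambda>v. h (frechet_derivative (f \<circ> chart_inv c) (at (snd c p)) v))) (at (snd c p))"
    by (rule bounded_linear.has_derivative[OF assms(1) assms(2)[unfolded frechet_derivative_works]])
  from frechet_derivative_at[OF this, symmetric] show ?thesis
    by (simp add: field_action_def o_def)
qed

lemma field_action_const [simp]: "field_action c X (\<lambda>q. k) p = 0"
  by (simp add: field_action_def o_def)

text \<open>
  The shape of the components of a deflection tensor: a derivative plus a contraction of the
  fibre coordinate with connection coefficients.
\<close>

lemma field_action_add_sum_mult:
  fixes f :: "'p \<Rightarrow> real"
  assumes "(f \<circ> chart_inv c) differentiable (at (snd c p))"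
    and "\<And>r. r \<in> I \<Longrightarrow> (g r \<circ> chart_inv c) differentiable (at (snd c p))"
    and "\<And>r. r \<in> I \<Longrightarrow> (h r \<circ> chart_inv c) differentiable (at (snd c p))"
    and p: "c \<in> A" "p \<in> fst c"
  shows "field_action c X (\<lambda>q. f q + (\<Sum>r\<in>I. g r q * h r q)) p =
    field_action c X f p + (\<Sum>r\<in>I. field_action c X (g r) p * h r p + g r p * field_action c X (h r) p)"
proof -
  let ?D = "\<lambda>F. frechet_derivative (F \<circ> chart_inv c) (at (snd c p))"
  have "((\<lambda>x. (f \<circ> chart_inv c) x + (\<Sum>r\<in>I. (g r \<circ> chart_inv c) x * (h r \<circ> chart_inv c) x)) has_derivative
      (\<lambda>v. ?D f v + (\<Sum>r\<in>I. (g r \<circ> chart_inv c) (snd c p) * ?D (h r) v + ?D (g r) v * (h r \<circ> chart_inv c) (snd c p))))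
      (at (snd c p))"
    by (intro has_derivative_add has_derivative_sum has_derivative_mult
        assms(1)[unfolded frechet_derivative_works] assms(2)[unfolded frechet_derivative_works]
        assms(3)[unfolded frechet_derivative_works])
  from frechet_derivative_at[OF this, symmetric] show ?thesis
    using p by (simp add: field_action_def o_def add.commute)
qed

end

lemma linear_adapted_comp: "linear (adapted_comp \<Gamma> \<Phi> e a)"
  by (cases a) (auto intro!: linearI simp: algebra_simps sum.distrib sum_distrib_left)

lemma sum_range_H: "(\<Sum>a\<in>range H. f a) = (\<Sum>i\<in>UNIV. f (H i))"
  and sum_range_V: "(\<Sum>a\<in>range V. f a) = (\<Sum>i\<in>UNIV. f (V i))"
  by (simp_all add: sum.reindex inj_on_def)

lemma vertical_part_vertical:
  "fst (\<Sum>a\<in>range V. adapted_comp \<Gamma> \<Phi> e a w *\<^sub>R adapted_vec \<Gamma> \<Phi> e a) = 0"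
  "fst (snd (\<Sum>a\<in>range V. adapted_comp \<Gamma> \<Phi> e a w *\<^sub>R adapted_vec \<Gamma> \<Phi> e a)) = 0"
  by (simp_all add: sum_range_V fst_sum snd_sum)

lemma vertical_expansion:
  fixes w :: "'n::finite jet_model"
  assumes "fst w = 0" "fst (snd w) = 0"
  shows "w = (\<Sum>l\<in>UNIV. adapted_comp \<Gamma> \<Phi> e (V l) w *\<^sub>R adapted_vec \<Gamma> \<Phi> e (V l))"
proof -
  have "(\<Sum>i\<in>UNIV. x i * axis i 1 $ k) = x k" for x :: "'n \<Rightarrow> real" and k
    by (simp add: axis_def if_distrib cong: if_cong)
  then show ?thesis
    using assms by (simp add: prod_eq_iff vec_eq_iff fst_sum snd_sum)
qed

locale gamma_linear = jet_base A for A :: "('m, real^'n::finite) chart set" +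
  fixes \<Gamma> :: "('m, 'n) nonlin_conn"
    and nabla :: "('m jet, 'n jet_model) connection"
    and \<Phi> :: "('m jet, 'n jet_model) chart"
  assumes nonlinear: "nonlinear_connection A \<Gamma>"
    and gamma: "Gamma_linear_connection A \<Gamma> nabla"
    and chart: "\<Phi> \<in> jet_atlas A"

sublocale gamma_linear \<subseteq> jet: atlas_connection "jet_atlas A" nabla
  using smooth_jet_atlas gamma unfolding Gamma_linear_connection_def by unfold_locales simp_all

context gamma_linear begin

abbreviation "E \<equiv> adapted_field A \<Gamma> \<Phi>"
abbreviation "conn_coeff \<equiv> adapted_coeff A \<Gamma> nabla \<Phi>"
abbreviation "der \<equiv> adapted_deriv A \<Gamma> \<Phi>"
abbreviation "defl \<equiv> deflection A \<Gamma> nabla \<Phi>"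

abbreviation smooth_here :: "('m jet \<Rightarrow> 'b::real_normed_vector) \<Rightarrow> bool" where
  "smooth_here f \<equiv> smooth_on (snd \<Phi> ` fst \<Phi>) (f \<circ> chart_inv \<Phi>)"

text \<open>
  The last components of the adapted basis vectors, namely \<open>- M\<close>, \<open>- N\<close> and the Kronecker symbol.
  They are at the same time the derivatives of the fibre coordinates along the adapted fields
  (lemma \<open>der_jet_y\<close> below).
\<close>

definition vert_vec :: "'n adapted_index \<Rightarrow> 'n \<Rightarrow> 'm jet \<Rightarrow> real" where
  "vert_vec a i e = snd (snd (adapted_vec \<Gamma> \<Phi> e a)) $ i"

lemma domain_open: "jet.opn (fst \<Phi>)"
  by (rule jet.openin_chart_domain[OF chart])

lemma image_open: "open (snd \<Phi> ` fst \<Phi>)"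
  using jet.open_chart_image[OF domain_open chart] by simp

lemma smooth_here_linear: "bounded_linear h \<Longrightarrow> smooth_here f \<Longrightarrow> smooth_here (\<lambda>e. h (f e))"
  using smooth_on_bounded_linear[OF _ image_open, of h "f \<circ> chart_inv \<Phi>"] by (simp add: o_def)

lemma smooth_here_cong:
  assumes "smooth_here g" "\<And>e. e \<in> fst \<Phi> \<Longrightarrow> f e = g e"
  shows "smooth_here f"
  by (rule smooth_on_transform[OF assms(1) image_open]) (use assms(2) chart in auto)

lemma smooth_here_differentiable:
  "smooth_here f \<Longrightarrow> e \<in> fst \<Phi> \<Longrightarrow> (f \<circ> chart_inv \<Phi>) differentiable (at (snd \<Phi> e))"
  by (rule smooth_on_differentiable) auto

lemma smooth_component:
  "X \<in> vector_fields (jet_atlas A) (fst \<Phi>) \<Longrightarrow> smooth_here (\<lambda>e. X e \<Phi>)"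
  using jet.vector_fieldsD(3)[of X "fst \<Phi>" \<Phi>, OF _ chart] by simp

lemma bounded_linear_vertical_component: "bounded_linear (\<lambda>w::'n jet_model. snd (snd w) $ i)"
  by (intro bounded_linear_compose[OF bounded_linear_vec_nth] bounded_linear_snd_comp bounded_linear_snd)

lemma smooth_nlc:
  "smooth_here (nlc_M \<Gamma> \<Phi>)" "smooth_here (nlc_N \<Gamma> \<Phi>)"
  using nonlinear chart unfolding nonlinear_connection_def by blast+

lemma smooth_adapted_vec: "smooth_here (\<lambda>e. adapted_vec \<Gamma> \<Phi> e a)"
proof (cases a)
  case T
  have "smooth_here (\<lambda>e. - nlc_M \<Gamma> \<Phi> e)"
    by (rule smooth_here_linear[OF bounded_linear_minus[OF bounded_linear_ident] smooth_nlc(1)])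
  then have "smooth_on (snd \<Phi> ` fst \<Phi>) (\<lambda>x. (1::real, 0::real^'n, ((\<lambda>e. - nlc_M \<Gamma> \<Phi> e) \<circ> chart_inv \<Phi>) x))"
    by (intro smooth_on_Pair image_open smooth_on_const)
  then show ?thesis by (simp add: T o_def)
next
  case (H i)
  have "linear (\<lambda>N::real^'n^'n. - (\<chi> j. N $ j $ i))"
    by (auto intro!: linearI simp: vec_eq_iff)
  then have "smooth_here (\<lambda>e. - (\<chi> j. nlc_N \<Gamma> \<Phi> e $ j $ i))"
    by (intro smooth_here_linear[of "\<lambda>N. - (\<chi> j. N $ j $ i)", OF _ smooth_nlc(2)])
      (simp add: linear_conv_bounded_linear)
  then have "smooth_on (snd \<Phi> ` fst \<Phi>)
      (\<lambda>x. (0::real, axis i 1 :: real^'n, ((\<lambda>e. - (\<chi> j. nlc_N \<Gamma> \<Phi> e $ j $ i)) \<circ> chart_inv \<Phi>) x))"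
    by (intro smooth_on_Pair image_open smooth_on_const)
  then show ?thesis by (simp add: H o_def)
next
  case (V i)
  show ?thesis by (simp add: V o_def smooth_on_const)
qed

lemma adapted_field_in_vector_fields: "E a \<in> vector_fields (jet_atlas A) (fst \<Phi>)"
  unfolding adapted_field_def
  by (rule jet.field_from_chart_in_vector_fields[OF domain_open chart subset_refl smooth_adapted_vec])

lemma adapted_field_here: "e \<in> fst \<Phi> \<Longrightarrow> E a e \<Phi> = adapted_vec \<Gamma> \<Phi> e a"
  by (simp add: adapted_field_def field_from_chart_def chart)

text \<open>
  Fibre directions form an invariant subbundle, so \<open>\<partial>/\<partial>y\<close> of the chart \<open>\<Phi>\<close> is fixed by the
  vertical projection computed in every chart.
\<close>

lemma vertical_proj_vertical_field: "adapted_proj A \<Gamma> (range V) (fst \<Phi>) (E (V r)) = E (V r)"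
proof (intro ext)
  fix e \<Psi>
  show "adapted_proj A \<Gamma> (range V) (fst \<Phi>) (E (V r)) e \<Psi> = E (V r) e \<Psi>"
  proof (cases "\<Psi> \<in> jet_atlas A \<and> e \<in> fst \<Phi> \<inter> fst \<Psi>")
    case True
    then have "E (V r) e \<Psi> = jacobian \<Phi> \<Psi> e (0, 0, axis r 1)"
      by (simp add: adapted_field_def field_from_chart_def)
    then have "fst (E (V r) e \<Psi>) = 0" "fst (snd (E (V r) e \<Psi>)) = 0"
      using jacobian_vertical[OF chart, of \<Psi> e] True by simp_all
    from vertical_expansion[OF this, of \<Gamma> \<Psi> e] show ?thesis
      using True unfolding adapted_proj_def sum_range_V by simp
  next
    case False
    then show ?thesis
      using jet.vector_fieldsD(1)[OF adapted_field_in_vector_fields False] by (auto simp: adapted_proj_def)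
  qed
qed

lemma nabla_adapted_in_vector_fields:
  "nabla (fst \<Phi>) (E a) (E b) \<in> vector_fields (jet_atlas A) (fst \<Phi>)"
  by (rule jet.connection_field[OF domain_open adapted_field_in_vector_fields adapted_field_in_vector_fields])

text \<open>
  This is where \<open>\<nabla>v = 0\<close> enters: covariant derivatives of vertical fields are vertical.
\<close>

lemma nabla_vertical_field:
  assumes "e \<in> fst \<Phi>"
  shows "fst (nabla (fst \<Phi>) (E a) (E (V r)) e \<Phi>) = 0" "fst (snd (nabla (fst \<Phi>) (E a) (E (V r)) e \<Phi>)) = 0"
proof -
  let ?W = "fst \<Phi>"
  have "\<forall>B \<in> {{T}, range H, range V}. \<forall>W. jet.opn W \<longrightarrow>
        (\<forall>X\<in>vector_fields (jet_atlas A) W. \<forall>Y\<in>vector_fields (jet_atlas A) W.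
           nabla W X (adapted_proj A \<Gamma> B W Y) = adapted_proj A \<Gamma> B W (nabla W X Y))"
    using gamma unfolding Gamma_linear_connection_def by (rule conjunct2)
  then have "\<forall>W. jet.opn W \<longrightarrow>
        (\<forall>X\<in>vector_fields (jet_atlas A) W. \<forall>Y\<in>vector_fields (jet_atlas A) W.
           nabla W X (adapted_proj A \<Gamma> (range V) W Y) = adapted_proj A \<Gamma> (range V) W (nabla W X Y))"
    by (rule bspec) simp
  from this[THEN spec, THEN mp, OF domain_open, THEN bspec, OF adapted_field_in_vector_fields,
      THEN bspec, OF adapted_field_in_vector_fields]
  have "nabla ?W (E a) (adapted_proj A \<Gamma> (range V) ?W (E (V r))) = adapted_proj A \<Gamma> (range V) ?W (nabla ?W (E a) (E (V r)))" .
  then have "nabla ?W (E a) (E (V r)) e \<Phi> = adapted_proj A \<Gamma> (range V) ?W (nabla ?W (E a) (E (V r))) e \<Phi>"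
    by (simp only: vertical_proj_vertical_field)
  also have "\<dots> = (\<Sum>b\<in>range V. adapted_comp \<Gamma> \<Phi> e b (nabla ?W (E a) (E (V r)) e \<Phi>) *\<^sub>R adapted_vec \<Gamma> \<Phi> e b)"
    using assms chart by (simp add: adapted_proj_def)
  finally have eq: "nabla ?W (E a) (E (V r)) e \<Phi> =
      (\<Sum>b\<in>range V. adapted_comp \<Gamma> \<Phi> e b (nabla ?W (E a) (E (V r)) e \<Phi>) *\<^sub>R adapted_vec \<Gamma> \<Phi> e b)" .
  show "fst (nabla ?W (E a) (E (V r)) e \<Phi>) = 0"
    by (subst eq) (rule vertical_part_vertical(1))
  show "fst (snd (nabla ?W (E a) (E (V r)) e \<Phi>)) = 0"
    by (subst eq) (rule vertical_part_vertical(2))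
qed

lemma smooth_vertical_coeff: "smooth_function (jet_atlas A) (fst \<Phi>) (conn_coeff (V l) (V r) a)"
proof (rule jet.smooth_functionI_chart[OF domain_open chart subset_refl])
  show "smooth_here (conn_coeff (V l) (V r) a)"
    by (rule smooth_here_cong[OF smooth_here_linear[OF bounded_linear_vertical_component
            smooth_component[OF nabla_adapted_in_vector_fields]]])
      (simp add: adapted_coeff_def nabla_vertical_field)
qed

lemma smooth_here_if_smooth_function: "smooth_function (jet_atlas A) (fst \<Phi>) f \<Longrightarrow> smooth_here f"
  using chart by (auto simp: smooth_function_def)

text \<open>
  The defining equations of the coefficients \<open>G\<close>, \<open>L\<close>, \<open>C\<close> of the vertical block, as an equation
  of fields and not only of components in \<open>\<Phi>\<close>.
\<close>

lemma nabla_vertical_field_expansion: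
  "nabla (fst \<Phi>) (E a) (E (V r)) = (\<lambda>e \<Psi>. \<Sum>l\<in>UNIV. conn_coeff (V l) (V r) a e *\<^sub>R E (V l) e \<Psi>)"
proof (rule jet.vector_field_eqI[OF nabla_adapted_in_vector_fields _ chart subset_refl])
  show "(\<lambda>e \<Psi>. \<Sum>l\<in>UNIV. conn_coeff (V l) (V r) a e *\<^sub>R E (V l) e \<Psi>) \<in> vector_fields (jet_atlas A) (fst \<Phi>)"
    by (rule jet.vector_fields_sum[OF domain_open smooth_vertical_coeff adapted_field_in_vector_fields])
  fix e assume e: "e \<in> fst \<Phi>"
  show "nabla (fst \<Phi>) (E a) (E (V r)) e \<Phi> = (\<Sum>l\<in>UNIV. conn_coeff (V l) (V r) a e *\<^sub>R E (V l) e \<Phi>)"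
    unfolding adapted_coeff_def adapted_field_here[OF e]
    by (rule vertical_expansion[OF nabla_vertical_field[OF e]])
qed

text \<open>
  The components of the bracket of two adapted fields. Depending on the pair of indices they
  are, up to sign, the tensors \<open>R\<close>, the derivatives of \<open>M\<close> and \<open>N\<close> along the fibres, or zero.
\<close>

definition bracket_coeff :: "'n adapted_index \<Rightarrow> 'n adapted_index \<Rightarrow> 'n \<Rightarrow> 'm jet \<Rightarrow> real" where
  "bracket_coeff b a s e = der b (vert_vec a s) e - der a (vert_vec b s) e"

text \<open>
  The time and position components of the adapted basis vectors are constant in the chart, so only
  the last components contribute to the bracket, and it is vertical.
\<close>

lemma adapted_bracket_here:
  assumes e: "e \<in> fst \<Phi>"
  shows "fst (lie_bracket (jet_atlas A) (fst \<Phi>) (E b) (E a) e \<Phi>) = 0"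
    "fst (snd (lie_bracket (jet_atlas A) (fst \<Phi>) (E b) (E a) e \<Phi>)) = 0"
    "snd (snd (lie_bracket (jet_atlas A) (fst \<Phi>) (E b) (E a) e \<Phi>)) $ s = bracket_coeff b a s e"
proof -
  have diff: "((\<lambda>q. adapted_vec \<Gamma> \<Phi> q c) \<circ> chart_inv \<Phi>) differentiable (at (snd \<Phi> e))" for c
    by (rule smooth_here_differentiable[OF smooth_adapted_vec e])
  have "field_action \<Phi> X (\<lambda>q. E c q \<Phi>) e = field_action \<Phi> X (\<lambda>q. adapted_vec \<Gamma> \<Phi> q c) e" for X c
    by (rule jet.field_action_cong[OF domain_open chart e e]) (rule adapted_field_here)
  then have br: "lie_bracket (jet_atlas A) (fst \<Phi>) (E b) (E a) e \<Phi> =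
      field_action \<Phi> (E b) (\<lambda>q. adapted_vec \<Gamma> \<Phi> q a) e - field_action \<Phi> (E a) (\<lambda>q. adapted_vec \<Gamma> \<Phi> q b) e"
    using e chart by (simp add: lie_bracket_def)
  have "fst (field_action \<Phi> X (\<lambda>q. adapted_vec \<Gamma> \<Phi> q c) e) = 0" for X c
  proof -
    show ?thesis
      using jet.field_action_bounded_linear[OF bounded_linear_fst diff, of X c] by (cases c) simp_all
  qed
  then show "fst (lie_bracket (jet_atlas A) (fst \<Phi>) (E b) (E a) e \<Phi>) = 0"
    unfolding br by simp
  have "fst (snd (field_action \<Phi> X (\<lambda>q. adapted_vec \<Gamma> \<Phi> q c) e)) = 0" for X c
  proof -
    show ?thesis
      using jet.field_action_bounded_linear[OF bounded_linear_fst_comp[OF bounded_linear_snd] diff, of X c]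
      by (cases c) simp_all
  qed
  then show "fst (snd (lie_bracket (jet_atlas A) (fst \<Phi>) (E b) (E a) e \<Phi>)) = 0"
    unfolding br by simp
  have "snd (snd (field_action \<Phi> X (\<lambda>q. adapted_vec \<Gamma> \<Phi> q c) e)) $ s = field_action \<Phi> X (vert_vec c s) e" for X c
    unfolding vert_vec_def
    by (rule jet.field_action_bounded_linear[OF bounded_linear_vertical_component diff, symmetric])
  then show "snd (snd (lie_bracket (jet_atlas A) (fst \<Phi>) (E b) (E a) e \<Phi>)) $ s = bracket_coeff b a s e"
    unfolding br bracket_coeff_def adapted_deriv_def by simp
qed

lemma adapted_bracket_in_vector_fields:
  "lie_bracket (jet_atlas A) (fst \<Phi>) (E b) (E a) \<in> vector_fields (jet_atlas A) (fst \<Phi>)"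
  by (rule jet.lie_bracket_in_vector_fields[OF domain_open adapted_field_in_vector_fields adapted_field_in_vector_fields])

lemma smooth_bracket_coeff: "smooth_function (jet_atlas A) (fst \<Phi>) (bracket_coeff b a s)"
proof (rule jet.smooth_functionI_chart[OF domain_open chart subset_refl])
  show "smooth_here (bracket_coeff b a s)"
    by (rule smooth_here_cong[OF smooth_here_linear[OF bounded_linear_vertical_component
            smooth_component[OF adapted_bracket_in_vector_fields]]])
      (simp add: adapted_bracket_here)
qed

lemma adapted_bracket_expansion:
  "lie_bracket (jet_atlas A) (fst \<Phi>) (E b) (E a) = (\<lambda>e \<Psi>. \<Sum>s\<in>UNIV. bracket_coeff b a s e *\<^sub>R E (V s) e \<Psi>)"
proof (rule jet.vector_field_eqI[OF adapted_bracket_in_vector_fields _ chart subset_refl])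
  show "(\<lambda>e \<Psi>. \<Sum>s\<in>UNIV. bracket_coeff b a s e *\<^sub>R E (V s) e \<Psi>) \<in> vector_fields (jet_atlas A) (fst \<Phi>)"
    by (rule jet.vector_fields_sum[OF domain_open smooth_bracket_coeff adapted_field_in_vector_fields])
  fix e assume e: "e \<in> fst \<Phi>"
  let ?L = "lie_bracket (jet_atlas A) (fst \<Phi>) (E b) (E a) e \<Phi>"
  have "?L = (\<Sum>s\<in>UNIV. adapted_comp \<Gamma> \<Phi> e (V s) ?L *\<^sub>R adapted_vec \<Gamma> \<Phi> e (V s))"
    by (rule vertical_expansion[OF adapted_bracket_here(1,2)[OF e]])
  also have "\<dots> = (\<Sum>s\<in>UNIV. bracket_coeff b a s e *\<^sub>R E (V s) e \<Phi>)"
    by (rule sum.cong[OF refl]) (simp add: adapted_bracket_here[OF e] adapted_field_here[OF e])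
  finally show "?L = (\<Sum>s\<in>UNIV. bracket_coeff b a s e *\<^sub>R E (V s) e \<Phi>)" .
qed

section \<open>Vertical curvature and deflection tensors\<close>

text \<open>
  The Leibniz rule applied to the expansion of \<open>\<nabla>\<^sub>a (\<partial>/\<partial>y\<^sup>r)\<close>.
\<close>

lemma second_nabla_vertical:
  assumes e: "e \<in> fst \<Phi>"
  shows "adapted_comp \<Gamma> \<Phi> e (V l) (nabla (fst \<Phi>) (E b) (nabla (fst \<Phi>) (E a) (E (V r))) e \<Phi>) =
    der b (conn_coeff (V l) (V r) a) e + (\<Sum>m\<in>UNIV. conn_coeff (V m) (V r) a e * conn_coeff (V l) (V m) b e)"
proof -
  note lin = linear_adapted_comp[of \<Gamma> \<Phi> e "V l"]
  have "nabla (fst \<Phi>) (E b) (nabla (fst \<Phi>) (E a) (E (V r))) e \<Phi> =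
    (\<Sum>m\<in>UNIV. field_action \<Phi> (E b) (conn_coeff (V m) (V r) a) e *\<^sub>R E (V m) e \<Phi> +
       conn_coeff (V m) (V r) a e *\<^sub>R nabla (fst \<Phi>) (E b) (E (V m)) e \<Phi>)"
    unfolding nabla_vertical_field_expansion[of a r]
    by (rule jet.connection_sum_right[OF domain_open adapted_field_in_vector_fields chart e e
          smooth_vertical_coeff adapted_field_in_vector_fields])
  then have "adapted_comp \<Gamma> \<Phi> e (V l) (nabla (fst \<Phi>) (E b) (nabla (fst \<Phi>) (E a) (E (V r))) e \<Phi>) =
    (\<Sum>m\<in>UNIV. der b (conn_coeff (V m) (V r) a) e * adapted_comp \<Gamma> \<Phi> e (V l) (adapted_vec \<Gamma> \<Phi> e (V m)) +
       conn_coeff (V m) (V r) a e * conn_coeff (V l) (V m) b e)"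
    by (simp only: linear_sum[OF lin] linear_add[OF lin] linear_scale[OF lin] adapted_field_here[OF e]
        adapted_deriv_def adapted_coeff_def[of A \<Gamma> nabla \<Phi> "V l" _ b] real_scaleR_def)
  also have "\<dots> = (\<Sum>m\<in>UNIV. der b (conn_coeff (V m) (V r) a) e * axis m 1 $ l) +
      (\<Sum>m\<in>UNIV. conn_coeff (V m) (V r) a e * conn_coeff (V l) (V m) b e)"
    by (simp add: sum.distrib)
  also have "(\<Sum>m\<in>UNIV. der b (conn_coeff (V m) (V r) a) e * axis m 1 $ l) = der b (conn_coeff (V l) (V r) a) e"
    by (simp add: axis_def if_distrib cong: if_cong)
  finally show ?thesis .
qed

text \<open>
  The classical expression of the curvature by the connection coefficients; the last sum comes from
  the bracket, since the adapted basis is not holonomic.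
\<close>

lemma vert_curv_components:
  assumes e: "e \<in> fst \<Phi>"
  shows "vert_curv A \<Gamma> nabla \<Phi> l r a b e =
    der b (conn_coeff (V l) (V r) a) e - der a (conn_coeff (V l) (V r) b) e
    + (\<Sum>m\<in>UNIV. conn_coeff (V m) (V r) a e * conn_coeff (V l) (V m) b e)
    - (\<Sum>m\<in>UNIV. conn_coeff (V m) (V r) b e * conn_coeff (V l) (V m) a e)
    - (\<Sum>s\<in>UNIV. bracket_coeff b a s e * conn_coeff (V l) (V r) (V s) e)"
proof -
  note lin = linear_adapted_comp[of \<Gamma> \<Phi> e "V l"]
  have "nabla (fst \<Phi>) (lie_bracket (jet_atlas A) (fst \<Phi>) (E b) (E a)) (E (V r)) e \<Phi> =
      (\<Sum>s\<in>UNIV. bracket_coeff b a s e *\<^sub>R nabla (fst \<Phi>) (E (V s)) (E (V r)) e \<Phi>)"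
    unfolding adapted_bracket_expansion
    by (rule jet.connection_sum_left[OF domain_open adapted_field_in_vector_fields
          smooth_bracket_coeff adapted_field_in_vector_fields])
  then have "adapted_comp \<Gamma> \<Phi> e (V l) (nabla (fst \<Phi>) (lie_bracket (jet_atlas A) (fst \<Phi>) (E b) (E a)) (E (V r)) e \<Phi>) =
      (\<Sum>s\<in>UNIV. bracket_coeff b a s e * conn_coeff (V l) (V r) (V s) e)"
    by (simp only: linear_sum[OF lin] linear_scale[OF lin] adapted_coeff_def real_scaleR_def)
  then show ?thesis
    unfolding vert_curv_def curvature_def linear_diff[OF lin] second_nabla_vertical[OF e] by simp
qed

lemma smooth_jet_y: "smooth_here (\<lambda>e. jet_y \<Phi> e i)"
proof (rule smooth_on_transform[OF smooth_on_bounded_linear[OF bounded_linear_vertical_component image_open smooth_on_ident] image_open])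
  show "((\<lambda>e. jet_y \<Phi> e i) \<circ> chart_inv \<Phi>) x = snd (snd x) $ i" if "x \<in> snd \<Phi> ` fst \<Phi>" for x
    using that chart by (auto simp: jet_y_def)
qed

lemma der_jet_y:
  assumes e: "e \<in> fst \<Phi>"
  shows "der a (\<lambda>e. jet_y \<Phi> e i) e = vert_vec a i e"
proof -
  have "frechet_derivative ((\<lambda>e. jet_y \<Phi> e i) \<circ> chart_inv \<Phi>) (at (snd \<Phi> e)) =
      frechet_derivative (\<lambda>x. snd (snd x) $ i) (at (snd \<Phi> e))"
    by (rule frechet_derivative_cong_open[OF image_open]) (use e chart in \<open>auto simp: jet_y_def\<close>)
  also have "\<dots> = (\<lambda>x. snd (snd x) $ i)"
    by (rule frechet_derivative_at[symmetric, OF bounded_linear_imp_has_derivative[OF bounded_linear_vertical_component]])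
  finally show ?thesis
    by (simp add: adapted_deriv_def field_action_def adapted_field_here[OF e] vert_vec_def)
qed

lemma smooth_vert_vec: "smooth_here (vert_vec a i)"
  unfolding vert_vec_def
  by (rule smooth_here_linear[OF bounded_linear_vertical_component smooth_adapted_vec])

text \<open>
  The components of \<open>\<nabla>\<^sub>a \<C>\<close> for the Liouville field \<open>\<C>\<close>.
\<close>

lemma deflection_components:
  assumes e: "e \<in> fst \<Phi>"
  shows "defl [V i] [a] e = vert_vec a i e + (\<Sum>r\<in>UNIV. jet_y \<Phi> e r * conn_coeff (V i) (V r) a e)"
proof -
  have "liouville \<Phi> [V r] [] = (\<lambda>e. jet_y \<Phi> e r)" for r
    by (rule ext) (simp add: liouville_def)
  then show ?thesis
    using der_jet_y[OF e] by (simp add: deflection_def cov_deriv_def sum_range_V)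
qed

lemma der_deflection:
  assumes e: "e \<in> fst \<Phi>"
  shows "der b (defl [V i] [a]) e = der b (vert_vec a i) e +
    (\<Sum>r\<in>UNIV. vert_vec b r e * conn_coeff (V i) (V r) a e + jet_y \<Phi> e r * der b (conn_coeff (V i) (V r) a) e)"
proof -
  have "der b (defl [V i] [a]) e =
      field_action \<Phi> (E b) (\<lambda>q. vert_vec a i q + (\<Sum>r\<in>UNIV. jet_y \<Phi> q r * conn_coeff (V i) (V r) a q)) e"
    unfolding adapted_deriv_def
    by (rule jet.field_action_cong[OF domain_open chart e e]) (rule deflection_components)
  also have "\<dots> = field_action \<Phi> (E b) (vert_vec a i) e + (\<Sum>r\<in>UNIV. field_action \<Phi> (E b) (\<lambda>e. jet_y \<Phi> e r) e * conn_coeff (V i) (V r) a e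
      + jet_y \<Phi> e r * field_action \<Phi> (E b) (conn_coeff (V i) (V r) a) e)"
    by (rule jet.field_action_add_sum_mult[OF _ _ _ chart e]; rule smooth_here_differentiable[OF _ e])
      (rule smooth_vert_vec smooth_jet_y smooth_here_if_smooth_function[OF smooth_vertical_coeff])+
  finally show ?thesis
    using der_jet_y[OF e] by (simp add: adapted_deriv_def)
qed

lemma cov_deriv_deflection:
  "cov_deriv A \<Gamma> nabla \<Phi> b defl [V i] [a] e = der b (defl [V i] [a]) e
    + (\<Sum>r\<in>UNIV. defl [V r] [a] e * conn_coeff (V i) (V r) b e)
    - (\<Sum>r\<in>index_block a. defl [V i] [r] e * conn_coeff r a b e)"
  by (simp add: cov_deriv_def sum_range_V)

lemma sum_mult_swap:
  fixes y w :: "'n \<Rightarrow> real"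
  shows "(\<Sum>s\<in>UNIV. (\<Sum>r\<in>UNIV. y r * c r s) * w s) = (\<Sum>r\<in>UNIV. y r * (\<Sum>s\<in>UNIV. c r s * w s))"
  by (simp only: sum_distrib_right sum_distrib_left mult.assoc) (rule sum.swap)

text \<open>
  The term \<open>\<nabla>\<^bsub>[X, Y]\<^esub> \<C>\<close> of the Ricci identity, with \<open>w\<close> the components of the bracket: its
  first part is the bracket acting on the fibre coordinate, its second part cancels the bracket
  term of the curvature.
\<close>

lemma sum_bracket:
  fixes w y :: "'n \<Rightarrow> real"
  shows "(\<Sum>s\<in>UNIV. (axis s 1 $ i + (\<Sum>r\<in>UNIV. y r * c r s)) * w s) =
     w i + (\<Sum>r\<in>UNIV. y r * (\<Sum>s\<in>UNIV. w s * c r s))"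
proof -
  have "(\<Sum>s\<in>UNIV. axis s 1 $ i * w s) = w i"
    by (simp add: axis_def if_distrib if_distribR cong: if_cong)
  moreover have "(\<Sum>s\<in>UNIV. (\<Sum>r\<in>UNIV. y r * c r s) * w s) = (\<Sum>r\<in>UNIV. y r * (\<Sum>s\<in>UNIV. w s * c r s))"
    unfolding sum_mult_swap by (simp only: mult.commute)
  ultimately show ?thesis
    by (simp add: distrib_right sum.distrib)
qed

text \<open>
  The Ricci identity for the Liouville field and an arbitrary pair of adapted indices. The mixed
  terms \<open>E\<^sub>b(y\<^sup>r) \<Gamma>\<^sub>a\<close> and \<open>E\<^sub>a(y\<^sup>r) \<Gamma>\<^sub>b\<close> that arise from differentiating the contraction cancel against
  the terms that the covariant derivative adds for the contravariant index. What remains is the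
  curvature contracted with \<open>y\<close>, the derivative of \<open>\<C>\<close> along the bracket, and the terms added
  for the covariant index.
\<close>

lemma deflection_identity:
  assumes e: "e \<in> fst \<Phi>"
  shows "cov_deriv A \<Gamma> nabla \<Phi> b defl [V i] [a] e - cov_deriv A \<Gamma> nabla \<Phi> a defl [V i] [b] e =
    (\<Sum>r\<in>UNIV. jet_y \<Phi> e r * vert_curv A \<Gamma> nabla \<Phi> i r a b e)
    + (\<Sum>s\<in>UNIV. defl [V i] [V s] e * bracket_coeff b a s e)
    - (\<Sum>r\<in>index_block a. defl [V i] [r] e * conn_coeff r a b e)
    + (\<Sum>r\<in>index_block b. defl [V i] [r] e * conn_coeff r b a e)"
proof -
  let ?y = "\<lambda>r. jet_y \<Phi> e r"
  let ?C = "\<lambda>c l r. conn_coeff (V l) (V r) c e"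
  let ?w = "\<lambda>s. bracket_coeff b a s e"
  have vv: "vert_vec (V s) i e = axis s 1 $ i" for s
    by (simp add: vert_vec_def)
  have swap: "(\<Sum>r\<in>UNIV. (\<Sum>m\<in>UNIV. ?y m * ?C c r m) * ?C d i r) = (\<Sum>r\<in>UNIV. ?y r * (\<Sum>m\<in>UNIV. ?C c m r * ?C d i m))" for c d
    by (rule sum_mult_swap)
  have "(\<Sum>r\<in>UNIV. ?y r * vert_curv A \<Gamma> nabla \<Phi> i r a b e)
      = (\<Sum>r\<in>UNIV. ?y r * der b (conn_coeff (V i) (V r) a) e) - (\<Sum>r\<in>UNIV. ?y r * der a (conn_coeff (V i) (V r) b) e)
      + (\<Sum>r\<in>UNIV. ?y r * (\<Sum>m\<in>UNIV. ?C a m r * ?C b i m))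
      - (\<Sum>r\<in>UNIV. ?y r * (\<Sum>m\<in>UNIV. ?C b m r * ?C a i m))
      - (\<Sum>r\<in>UNIV. ?y r * (\<Sum>s\<in>UNIV. ?w s * ?C (V s) i r))"
    unfolding vert_curv_components[OF e]
    by (simp add: distrib_left right_diff_distrib sum.distrib sum_subtractf)
  moreover have "(\<Sum>s\<in>UNIV. defl [V i] [V s] e * ?w s) = ?w i + (\<Sum>r\<in>UNIV. ?y r * (\<Sum>s\<in>UNIV. ?w s * ?C (V s) i r))"
    unfolding deflection_components[OF e] vv by (rule sum_bracket)
  moreover have "der b (defl [V i] [a]) e + (\<Sum>r\<in>UNIV. defl [V r] [a] e * ?C b i r) =
      der b (vert_vec a i) e + (\<Sum>r\<in>UNIV. vert_vec b r e * ?C a i r) + (\<Sum>r\<in>UNIV. ?y r * der b (conn_coeff (V i) (V r) a) e)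
      + (\<Sum>r\<in>UNIV. vert_vec a r e * ?C b i r) + (\<Sum>r\<in>UNIV. ?y r * (\<Sum>m\<in>UNIV. ?C a m r * ?C b i m))" for a b
    unfolding der_deflection[OF e] deflection_components[OF e]
    by (simp add: distrib_right sum.distrib swap)
  ultimately show ?thesis
    unfolding cov_deriv_deflection bracket_coeff_def by simp
qed

lemma der_minus:
  assumes "smooth_here f" "e \<in> fst \<Phi>"
  shows "der a (\<lambda>q. - f q) e = - der a f e"
  unfolding adapted_deriv_def
  by (rule jet.field_action_bounded_linear[OF bounded_linear_minus[OF bounded_linear_ident] smooth_here_differentiable[OF assms]])

lemma smooth_nlc_components:
  "smooth_here (\<lambda>q. nlc_M \<Gamma> \<Phi> q $ r)" "smooth_here (\<lambda>q. nlc_N \<Gamma> \<Phi> q $ r $ j)"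
  by (rule smooth_here_linear[OF bounded_linear_vec_nth smooth_nlc(1)]
      smooth_here_linear[OF bounded_linear_compose[OF bounded_linear_vec_nth bounded_linear_vec_nth] smooth_nlc(2)])+

lemma der_vert_vec:
  assumes e: "e \<in> fst \<Phi>"
  shows "der a (vert_vec T s) e = - der a (\<lambda>q. nlc_M \<Gamma> \<Phi> q $ s) e"
    "der a (vert_vec (H j) s) e = - der a (\<lambda>q. nlc_N \<Gamma> \<Phi> q $ s $ j) e"
    "der a (vert_vec (V j) s) e = 0"
  using der_minus[OF smooth_nlc_components(1) e] der_minus[OF smooth_nlc_components(2) e]
  by (simp_all add: vert_vec_def[abs_def] adapted_deriv_def)

lemma bracket_coeffs:
  assumes e: "e \<in> fst \<Phi>"
  shows "bracket_coeff (H k) T s e = - tors_R1 A \<Gamma> \<Phi> s k e"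
    "bracket_coeff (H k) (H j) s e = - tors_R A \<Gamma> \<Phi> s j k e"
    "bracket_coeff (V k) T s e = - der (V k) (\<lambda>q. nlc_M \<Gamma> \<Phi> q $ s) e"
    "bracket_coeff (V k) (H j) s e = - der (V k) (\<lambda>q. nlc_N \<Gamma> \<Phi> q $ s $ j) e"
    "bracket_coeff (V k) (V j) s e = 0"
  by (simp_all add: bracket_coeff_def der_vert_vec[OF e] tors_R1_def tors_R_def)

end

theorem theorem4p4:
  fixes A :: "('m, real^'n::finite) chart set"
    and \<Gamma> :: "('m, 'n) nonlin_conn"
    and nabla :: "('m jet, 'n jet_model) connection"
    and \<Phi> :: "('m jet, 'n jet_model) chart"
    and e :: "'m jet"
  assumes "smooth_manifold A"
    and "nonlinear_connection A \<Gamma>"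
    and "Gamma_linear_connection A \<Gamma> nabla"
    and "\<Phi> \<in> jet_atlas A"
    and "e \<in> fst \<Phi>"
  shows
    "(\<forall>i k. defl_Dbar_cov A \<Gamma> nabla \<Phi> i (H k) e - defl_D_cov A \<Gamma> nabla \<Phi> i k T e =
        (\<Sum>r\<in>UNIV. jet_y \<Phi> e r * vert_curv A \<Gamma> nabla \<Phi> i r T (H k) e)
        - defl_Dbar A \<Gamma> nabla \<Phi> i e * tors_Tbar A \<Gamma> nabla \<Phi> k e
        - (\<Sum>r\<in>UNIV. defl_D A \<Gamma> nabla \<Phi> i r e * tors_T1 A \<Gamma> nabla \<Phi> r k e)
        - (\<Sum>r\<in>UNIV. defl_d A \<Gamma> nabla \<Phi> i r e * tors_R1 A \<Gamma> \<Phi> r k e)) \<and>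
     (\<forall>i j k. defl_D_cov A \<Gamma> nabla \<Phi> i j (H k) e - defl_D_cov A \<Gamma> nabla \<Phi> i k (H j) e =
        (\<Sum>r\<in>UNIV. jet_y \<Phi> e r * vert_curv A \<Gamma> nabla \<Phi> i r (H j) (H k) e)
        - (\<Sum>r\<in>UNIV. defl_D A \<Gamma> nabla \<Phi> i r e * tors_T A \<Gamma> nabla \<Phi> r j k e)
        - (\<Sum>r\<in>UNIV. defl_d A \<Gamma> nabla \<Phi> i r e * tors_R A \<Gamma> \<Phi> r j k e)) \<and>
     (\<forall>i k. defl_Dbar_cov A \<Gamma> nabla \<Phi> i (V k) e - defl_d_cov A \<Gamma> nabla \<Phi> i k T e =
        (\<Sum>r\<in>UNIV. jet_y \<Phi> e r * vert_curv A \<Gamma> nabla \<Phi> i r T (V k) e)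
        - defl_Dbar A \<Gamma> nabla \<Phi> i e * adapted_coeff A \<Gamma> nabla \<Phi> T T (V k) e
        - (\<Sum>r\<in>UNIV. defl_d A \<Gamma> nabla \<Phi> i r e * tors_P1 A \<Gamma> nabla \<Phi> r k e)) \<and>
     (\<forall>i j k. defl_D_cov A \<Gamma> nabla \<Phi> i j (V k) e - defl_d_cov A \<Gamma> nabla \<Phi> i k (H j) e =
        (\<Sum>r\<in>UNIV. jet_y \<Phi> e r * vert_curv A \<Gamma> nabla \<Phi> i r (H j) (V k) e)
        - (\<Sum>r\<in>UNIV. defl_D A \<Gamma> nabla \<Phi> i r e * adapted_coeff A \<Gamma> nabla \<Phi> (H r) (H j) (V k) e)
        - (\<Sum>r\<in>UNIV. defl_d A \<Gamma> nabla \<Phi> i r e * tors_P A \<Gamma> nabla \<Phi> r j k e)) \<and>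
     (\<forall>i j k. defl_d_cov A \<Gamma> nabla \<Phi> i j (V k) e - defl_d_cov A \<Gamma> nabla \<Phi> i k (V j) e =
        (\<Sum>r\<in>UNIV. jet_y \<Phi> e r * vert_curv A \<Gamma> nabla \<Phi> i r (V j) (V k) e)
        - (\<Sum>r\<in>UNIV. defl_d A \<Gamma> nabla \<Phi> i r e * tors_S A \<Gamma> nabla \<Phi> r j k e))"
proof -
  interpret gamma_linear A \<Gamma> nabla \<Phi>
    using assms(1-4) by unfold_locales (simp_all add: smooth_manifold_def)
  \<comment> \<open>Each identity is the Ricci identity for one kind of index pair; the terms from the covariant index are regrouped with the bracket components.\<close>
  note identity = deflection_identity[OF assms(5)]
  show ?thesis
    unfolding defl_Dbar_cov_def defl_D_cov_def defl_d_cov_def defl_Dbar_def defl_D_def defl_d_def identity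
      bracket_coeffs[OF assms(5)] tors_Tbar_def tors_T1_def tors_T_def tors_P1_def tors_P_def tors_S_def
    by (simp add: sum_range_H sum_range_V sum_negf right_diff_distrib sum_subtractf)
qed

end
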